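(* Let $\underline{S}=(S,1_S,\bullet)$ be a finite germ with $|S|=n$, and assume that the partial binary operation $\bullet$ can be computed in time $O(1)$. Then the following hold for the functions described in the context. (i) The function IsLeftAssociative decides in time $O(n^3)$ whether $\underline{S}$ is left-associative. (ii) The function LeftDivisibility decides whether $\underline{S}$ is left-cancellative and, if it is, computes the left-divisibility relation $\preccurlyeq_S$ on $S$ with respect to $\bullet$, in time $O(n^2)$. (iii) Given the left-divisibility relation $\preccurlyeq_S$, the function NonAscending computes a non-ascending sequence containing the elements of $S$ in time $O(n^2)$. (iv) Given a composable pair $(a_1,a_2)$ of elements of $S$ (target of $a_1$ = source of $a_2$), a non-ascending sequence $S'$ containing the elements of $S$, and the left-divisibility relation $\preccurlyeq_S$, the function JHasGreatestElement decides in time $O(n)$ whether $\mathcal{J}_S(a_1,a_2)$ has a $\preccurlyeq_S$-greatest element. (v) It is decidable in time $O(n^3)$ whether $\underline{S}$ is a Garside germ.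
   Context: Categories are viewed as monoids with a partial product: each element has a source and a target, $fg$ is defined iff the target of $f$ equals the source of $g$, and there is an identity element $1_x$ for each object $x$. A precategory is a family of elements with source and target maps to a family of objects. Germ: a triple $(S,1_S,\bullet)$ where $S$ is a precategory, $1_S$ consists of one element $1_x\in S$ with source and target $x$ for each object $x$, and $\bullet$ is a partial map from composable pairs of elements of $S$ to $S$ such that: if $a\bullet b$ is defined, its source is that of $a$ and its target is that of $b$; $1_x\bullet a=a=a\bullet 1_y$ for each $a\in S$ with source $x$ and target $y$; if $a\bullet b$ and $b\bullet c$ are defined, then $(a\bullet b)\bullet c$ is defined iff $a\bullet(b\bullet c)$ is, in which case they are equal. The germ is left-associative if, whenever $(a\bullet b)\bullet c$ is defined, $b\bullet c$ is defined. It is left-cancellative if, whenever $a\bullet b$ and $a\bullet b'$ are defined and equal, $b=b'$. $\mathcal{C}at(\underline{S})$ is the category with generators $S$ and relations $a\,b=a\bullet b$ for all $a,b\in S$ with $a\bullet b$ defined. A category is left-cancellative if $fg=fg'$ implies $g=g'$. In a left-cancellative category $\mathcal{C}$: $f\preccurlyeq g$ means $fg'=g$ for some $g'\in\mathcal{C}$; $\mathcal{C}^\times$ is the family of invertible elements; for $S\subseteq\mathcal{C}$, $S^\sharp=S\mathcal{C}^\times\cup\mathcal{C}^\times$. A path $g_1|\cdots|g_p$ is $S$-normal if all $g_i\in S^\sharp$ and, for all $i<p$, $a\in S$, $f\in\mathcal{C}$, $a\preccurlyeq fg_ig_{i+1}$ implies $a\preccurlyeq fg_i$. $S$ is a Garside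 family in $\mathcal{C}$ if every element of $\mathcal{C}$ is the product of an $S$-normal path. The germ $\underline{S}$ is a Garside germ if $S$ embeds in $\mathcal{C}at(\underline{S})$, the latter is left-cancellative, and the image of $S$ is a Garside family in it. For $a,b\in S$, $a\preccurlyeq_S b$ (local left-divisibility) means that $b=a\bullet b'$ for some $b'\in S$; $a\prec_S b$ means $a\preccurlyeq_S b$ and not $b\preccurlyeq_S a$. A sequence $a_1,\dots,a_m$ in $S$ is non-ascending if $a_i\prec_S a_j$ fails for all $i<j$. For $(a_1,a_2)$ composable in $S$, $\mathcal{J}_S(a_1,a_2)=\{b\in S\mid a_1\bullet b\text{ is defined and }b\preccurlyeq_S a_2\}$; a $\preccurlyeq_S$-greatest element of it is an element $c$ of it with $b\preccurlyeq_S c$ for all its elements $b$. Functions. IsLeftAssociative: for all composable triples $(a,b,c)$ in $S$, return false if $(a\bullet b)\bullet c$ is defined but $b\bullet c$ is not; return true at the end. LeftDivisibility: for each $a\in S$, set the truth value of $a\preccurlyeq_S b$ to false for all $b\in S$; then for each $b\in S$ with $a\bullet b$ defined, return false if the truth value of $a\preccurlyeq_S a\bullet b$ is already true, otherwise set it to true. At the end return true and the table of truth values. NonAscending: start with the empty list $S'$; for each $a\in S$, if some entry $S'[i]$ satisfies $S'[i]\prec_S a$, insert $a$ into $S'$ at the least such position $i$, otherwise append $a$ at the end of $S'$. Return $S'$. JHasGreatestElement: scan $S'$ in order; let $c$ be the first entry lying in $\mathcal{J}_S(a_1,a_2)$; return false as soon as a later entry of $S'$ lying in $\mathcal{J}_S(a_1,a_2)$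 does not satisfy $\preccurlyeq_S c$; otherwise return true.
   Formalization: Correctness in (iii) and (iv) is claimed only when the relation ≼_S is transitive (true in every left-associative germ), and (v) decides whether the germ is left-associative and Garside; without this (iii)–(v) fail. In (iii) and (iv) the sequence lists each element exactly once. *)

theory Defs
  imports Main "HOL-Library.Landau_Symbols"
begin

section \<open>Germs and categories\<close>

text \<open>
  One record serves for germs and for categories, the latter being viewed as monoids with a
  partial product: \<open>mul M a b = None\<close> means that the product of \<open>a\<close> and \<open>b\<close> is undefined.
  Composition is in diagrammatic order.
\<close>

record ('o, 'a) pmon =
  Ob :: "'o set"
  El :: "'a set"
  src :: "'a \<Rightarrow> 'o"
  tgt :: "'a \<Rightarrow> 'o"
  ident :: "'o \<Rightarrow> 'a"
  mul :: "'a \<Rightarrow> 'a \<Rightarrow> 'a option"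

locale germ =
  fixes M :: "('o, 'a) pmon"
  assumes src_Ob: "a \<in> El M \<Longrightarrow> src M a \<in> Ob M"
    and tgt_Ob: "a \<in> El M \<Longrightarrow> tgt M a \<in> Ob M"
    and ident_El: "x \<in> Ob M \<Longrightarrow> ident M x \<in> El M"
    and src_ident: "x \<in> Ob M \<Longrightarrow> src M (ident M x) = x"
    and tgt_ident: "x \<in> Ob M \<Longrightarrow> tgt M (ident M x) = x"
    and mul_dom: "mul M a b = Some c \<Longrightarrow> a \<in> El M \<and> b \<in> El M \<and> tgt M a = src M b"
    and mul_cod: "mul M a b = Some c \<Longrightarrow> c \<in> El M \<and> src M c = src M a \<and> tgt M c = tgt M b"
    and ident_mul: "a \<in> El M \<Longrightarrow> mul M (ident M (src M a)) a = Some a"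
    and mul_ident: "a \<in> El M \<Longrightarrow> mul M a (ident M (tgt M a)) = Some a"
    \<comment> \<open>an equation between options: one side is defined iff the other one is\<close>
    and mul_assoc: "mul M a b = Some ab \<Longrightarrow> mul M b c = Some bc \<Longrightarrow> mul M ab c = mul M a bc"

text \<open>A category is a germ in which all composable pairs have a product.\<close>

locale category = germ +
  assumes mul_total:
    "a \<in> El M \<Longrightarrow> b \<in> El M \<Longrightarrow> tgt M a = src M b \<Longrightarrow> \<exists>c. mul M a b = Some c"

definition left_associative :: "('o, 'a) pmon \<Rightarrow> bool" where
  "left_associative M \<longleftrightarrow>
     (\<forall>a b c ab abc. mul M a b = Some ab \<and> mul M ab c = Some abc \<longrightarrow> (\<exists>bc. mul M b c = Some bc))"

definition left_cancellative :: "('o, 'a) pmon \<Rightarrow> bool" where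
  "left_cancellative M \<longleftrightarrow>
     (\<forall>a b b' c. mul M a b = Some c \<and> mul M a b' = Some c \<longrightarrow> b = b')"

text \<open>Local left-divisibility in a germ, left-divisibility in a category.\<close>

definition ldiv :: "('o, 'a) pmon \<Rightarrow> 'a \<Rightarrow> 'a \<Rightarrow> bool" where
  "ldiv M a b \<longleftrightarrow> (\<exists>b'\<in>El M. mul M a b' = Some b)"

definition sldiv :: "('o, 'a) pmon \<Rightarrow> 'a \<Rightarrow> 'a \<Rightarrow> bool" where
  "sldiv M a b \<longleftrightarrow> ldiv M a b \<and> \<not> ldiv M b a"

definition non_ascending :: "('o, 'a) pmon \<Rightarrow> 'a list \<Rightarrow> bool" where
  "non_ascending M as \<longleftrightarrow> (\<forall>i j. i < j \<and> j < length as \<longrightarrow> \<not> sldiv M (as ! i) (as ! j))"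

definition JS :: "('o, 'a) pmon \<Rightarrow> 'a \<Rightarrow> 'a \<Rightarrow> 'a set" where
  "JS M a1 a2 = {b \<in> El M. (\<exists>c. mul M a1 b = Some c) \<and> ldiv M b a2}"

definition is_greatest :: "('o, 'a) pmon \<Rightarrow> 'a set \<Rightarrow> 'a \<Rightarrow> bool" where
  "is_greatest M A c \<longleftrightarrow> c \<in> A \<and> (\<forall>b\<in>A. ldiv M b c)"

text \<open>
  In a germ that is not left-associative, local left-divisibility need not be transitive.
\<close>

lemma left_associative_imp_transp_ldiv:
  assumes "germ M" "left_associative M"
  shows "transp (ldiv M)"
proof (rule transpI)
  fix a b c assume "ldiv M a b" "ldiv M b c"
  then obtain u v where u: "mul M a u = Some b" and v: "mul M b v = Some c"
    by (auto simp: ldiv_def)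
  then obtain w where w: "mul M u v = Some w"
    using assms(2) unfolding left_associative_def by blast
  have "mul M a w = Some c"
    using germ.mul_assoc[OF assms(1) u w] v by simp
  then show "ldiv M a c"
    using germ.mul_cod[OF assms(1) w] by (auto simp: ldiv_def)
qed


section \<open>The category presented by a germ\<close>

fun is_path :: "('o, 'a) pmon \<Rightarrow> 'o \<Rightarrow> 'a list \<Rightarrow> 'o \<Rightarrow> bool" where
  "is_path M x [] y \<longleftrightarrow> x \<in> Ob M \<and> x = y"
| "is_path M x (a # w) y \<longleftrightarrow> a \<in> El M \<and> src M a = x \<and> is_path M (tgt M a) w y"

text \<open>
  The congruence on paths from \<open>x\<close> to \<open>y\<close>. Besides the relations \<open>a b = a \<bullet> b\<close>, the
  distinguished elements of the germ are identified with the identities, i.e. the empty paths, of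
  the category; otherwise these elements would be non-trivial idempotents and the category would
  never be left-cancellative.
\<close>

inductive pcong :: "('o, 'a) pmon \<Rightarrow> 'o \<Rightarrow> 'o \<Rightarrow> 'a list \<Rightarrow> 'a list \<Rightarrow> bool"
  for M x y where
  pcong_mul: "is_path M x (u @ [a, b] @ v) y \<Longrightarrow> mul M a b = Some c
    \<Longrightarrow> pcong M x y (u @ [a, b] @ v) (u @ [c] @ v)"
| pcong_ident: "is_path M x (u @ [ident M z] @ v) y \<Longrightarrow> z \<in> Ob M
    \<Longrightarrow> pcong M x y (u @ [ident M z] @ v) (u @ v)"
| pcong_refl: "is_path M x u y \<Longrightarrow> pcong M x y u u"
| pcong_sym: "pcong M x y u v \<Longrightarrow> pcong M x y v u"
| pcong_trans: "pcong M x y u v \<Longrightarrow> pcong M x y v w \<Longrightarrow> pcong M x y u w"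

definition paths :: "('o, 'a) pmon \<Rightarrow> ('o \<times> 'a list \<times> 'o) set" where
  "paths M = {(x, w, y). is_path M x w y}"

definition path_rel :: "('o, 'a) pmon \<Rightarrow> ('o \<times> 'a list \<times> 'o) rel" where
  "path_rel M = {((x, u, y), (x, v, y)) | x y u v. pcong M x y u v}"

definition Cat :: "('o, 'a) pmon \<Rightarrow> ('o, ('o \<times> 'a list \<times> 'o) set) pmon" where
  "Cat M =
    (let E = paths M // path_rel M;
         s = (\<lambda>X. THE x. \<exists>w y. (x, w, y) \<in> X);
         t = (\<lambda>X. THE y. \<exists>x w. (x, w, y) \<in> X)
     in \<lparr> Ob = Ob M, El = E, src = s, tgt = t,
          ident = (\<lambda>x. path_rel M `` {(x, [], x)}),
          mul = (\<lambda>X Y. if X \<in> E \<and> Y \<in> E \<and> t X = s Y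
             then Some (path_rel M ``
               {(x, u @ v, z) | x u y v z. (x, u, y) \<in> X \<and> (y, v, z) \<in> Y})
             else None) \<rparr>)"

definition gen :: "('o, 'a) pmon \<Rightarrow> 'a \<Rightarrow> ('o \<times> 'a list \<times> 'o) set" where
  "gen M a = path_rel M `` {(src M a, [a], tgt M a)}"

context germ
begin

lemma is_path_append: "is_path M x (u @ v) y \<longleftrightarrow> (\<exists>z. is_path M x u z \<and> is_path M z v y)"
proof (induction u arbitrary: x)
  case Nil
  show ?case by (cases v) (auto simp: src_Ob)
qed auto

lemma is_path_Ob: "is_path M x u y \<Longrightarrow> x \<in> Ob M \<and> y \<in> Ob M"
  by (induction u arbitrary: x) (auto simp: src_Ob)

lemma pcong_is_path: "pcong M x y u v \<Longrightarrow> is_path M x u y \<and> is_path M x v y"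
proof (induction rule: pcong.induct)
  case (pcong_mul u a b v c)
  then show ?case
    using mul_dom[OF pcong_mul(2)] mul_cod[OF pcong_mul(2)] by (auto simp: is_path_append)
next
  case (pcong_ident u z v)
  then show ?case by (auto simp: is_path_append src_ident tgt_ident)
qed auto

lemma pcong_context:
  "pcong M x y u v \<Longrightarrow> is_path M x' p x \<Longrightarrow> is_path M y q y' \<Longrightarrow> pcong M x' y' (p @ u @ q) (p @ v @ q)"
proof (induction rule: pcong.induct)
  case (pcong_mul u a b v c)
  then have "is_path M x' ((p @ u) @ [a, b] @ v @ q) y'"
    unfolding is_path_append by blast
  from pcong.pcong_mul[OF this pcong_mul.hyps(2)] show ?case by simp
next
  case (pcong_ident u z v)
  then have "is_path M x' ((p @ u) @ [ident M z] @ v @ q) y'"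
    unfolding is_path_append by blast
  from pcong.pcong_ident[OF this pcong_ident.hyps(2)] show ?case by simp
next
  case (pcong_refl u)
  then show ?case unfolding is_path_append by (intro pcong.pcong_refl) (auto simp: is_path_append)
qed (blast intro: pcong_sym pcong_trans)+

lemma pcong_append:
  assumes "pcong M x y u u'" "pcong M y z v v'"
  shows "pcong M x z (u @ v) (u' @ v')"
proof -
  note p = pcong_is_path[OF assms(1)] pcong_is_path[OF assms(2)]
  have "pcong M x z ([] @ u @ v) ([] @ u' @ v)"
    using p assms(1) by (intro pcong_context) (auto dest: is_path_Ob)
  moreover have "pcong M x z (u' @ v @ []) (u' @ v' @ [])"
    using p assms(2) by (intro pcong_context) (auto dest: is_path_Ob)
  ultimately show ?thesis by (auto intro: pcong_trans)
qed

abbreviation cls :: "'o \<Rightarrow> 'a list \<Rightarrow> 'o \<Rightarrow> ('o \<times> 'a list \<times> 'o) set" where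
  "cls x w y \<equiv> path_rel M `` {(x, w, y)}"

lemma path_rel_iff:
  "((x, u, y), (x', v, y')) \<in> path_rel M \<longleftrightarrow> x' = x \<and> y' = y \<and> pcong M x y u v"
  by (auto simp: path_rel_def)

lemma equiv_path_rel: "equiv (paths M) (path_rel M)"
  by (rule equivI)
     (auto simp: refl_on_def sym_def trans_def path_rel_def paths_def
       intro: pcong_refl pcong_sym pcong_trans dest: pcong_is_path)

lemma cls_eqI: "pcong M x y u v \<Longrightarrow> cls x u y = cls x v y"
  by (rule equiv_class_eq[OF equiv_path_rel]) (auto simp: path_rel_def)

lemma Cat_El_iff: "X \<in> El (Cat M) \<longleftrightarrow> (\<exists>x w y. is_path M x w y \<and> X = cls x w y)"
  by (auto simp: Cat_def Let_def quotient_def paths_def)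

lemma Cat_src: "is_path M x w y \<Longrightarrow> src (Cat M) (cls x w y) = x"
  by (auto simp: Cat_def Let_def path_rel_iff intro!: the_equality pcong_refl)

lemma Cat_tgt: "is_path M x w y \<Longrightarrow> tgt (Cat M) (cls x w y) = y"
  by (auto simp: Cat_def Let_def path_rel_iff intro!: the_equality pcong_refl)

lemma Cat_mul:
  assumes "is_path M x u y" "is_path M y v z"
  shows "mul (Cat M) (cls x u y) (cls y v z) = Some (cls x (u @ v) z)"
proof -
  let ?A = "{(a, u' @ v', c) | a u' b v' c. (a, u', b) \<in> cls x u y \<and> (b, v', c) \<in> cls y v z}"
  have sub: "w \<in> cls x (u @ v) z" if "w \<in> ?A" for w
    using that by (auto simp: path_rel_iff intro: pcong_append)
  have mem: "(x, u @ v, z) \<in> ?A"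
    using assms by (auto simp: path_rel_iff intro: pcong_refl)
  have "path_rel M `` ?A = cls x (u @ v) z"
  proof (intro equalityI subsetI)
    fix q assume "q \<in> path_rel M `` ?A"
    then obtain w where "w \<in> ?A" "(w, q) \<in> path_rel M" by blast
    with sub[of w] show "q \<in> cls x (u @ v) z"
      using equiv_path_rel by (auto dest: equivE elim!: transE simp: equiv_def)
  qed (use mem in blast)
  moreover have "mul (Cat M) (cls x u y) (cls y v z) =
      (if cls x u y \<in> El (Cat M) \<and> cls y v z \<in> El (Cat M)
          \<and> tgt (Cat M) (cls x u y) = src (Cat M) (cls y v z)
       then Some (path_rel M `` ?A) else None)"
    by (simp add: Cat_def Let_def)
  moreover have "cls x u y \<in> El (Cat M)" "cls y v z \<in> El (Cat M)"
    using assms by (auto simp: Cat_El_iff)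
  ultimately show ?thesis
    by (simp add: Cat_src[OF assms(2)] Cat_tgt[OF assms(1)])
qed

lemma Cat_mul_cases:
  assumes "mul (Cat M) X Y = Some Z"
  obtains x u y v z where "is_path M x u y" "is_path M y v z"
    "X = cls x u y" "Y = cls y v z" "Z = cls x (u @ v) z"
proof -
  have "X \<in> El (Cat M)" "Y \<in> El (Cat M)" and e: "tgt (Cat M) X = src (Cat M) Y"
    using assms by (auto simp: Cat_def Let_def split: if_splits)
  then obtain x u y y' v z where *: "is_path M x u y" "X = cls x u y"
      "is_path M y' v z" "Y = cls y' v z"
    unfolding Cat_El_iff by blast
  with e have "y' = y" by (simp add: Cat_src Cat_tgt)
  with * show ?thesis using assms Cat_mul[of x u y v z] by (intro that[of x u y v z]) auto
qed

lemma category_Cat: "category (Cat M)"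
proof
  fix X assume "X \<in> El (Cat M)"
  then obtain x w y where *: "is_path M x w y" and X: "X = cls x w y" unfolding Cat_El_iff by blast
  have ob: "Ob (Cat M) = Ob M" by (simp add: Cat_def Let_def)
  have id: "ident (Cat M) z = cls z [] z" for z by (simp add: Cat_def Let_def)
  have xy: "is_path M x [] x" "is_path M y [] y" using is_path_Ob[OF *] by auto
  show "src (Cat M) X \<in> Ob (Cat M)" "tgt (Cat M) X \<in> Ob (Cat M)"
    using * is_path_Ob[OF *] by (auto simp: X ob Cat_src Cat_tgt)
  show "mul (Cat M) (ident (Cat M) (src (Cat M) X)) X = Some X"
    using Cat_mul[OF xy(1) *] by (simp add: X id Cat_src[OF *])
  show "mul (Cat M) X (ident (Cat M) (tgt (Cat M) X)) = Some X"
    using Cat_mul[OF * xy(2)] by (simp add: X id Cat_tgt[OF *])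
next
  fix x assume "x \<in> Ob (Cat M)"
  then have *: "is_path M x [] x" by (simp add: Cat_def Let_def)
  have id: "ident (Cat M) x = cls x [] x" by (simp add: Cat_def Let_def)
  show "ident (Cat M) x \<in> El (Cat M)" using * unfolding id Cat_El_iff by blast
  show "src (Cat M) (ident (Cat M) x) = x" "tgt (Cat M) (ident (Cat M) x) = x"
    using Cat_src[OF *] Cat_tgt[OF *] by (simp_all add: id)
next
  fix X Y Z assume "mul (Cat M) X Y = Some Z"
  then obtain x u y v z where *: "is_path M x u y" "is_path M y v z"
    "X = cls x u y" "Y = cls y v z" "Z = cls x (u @ v) z" by (rule Cat_mul_cases)
  then have **: "is_path M x (u @ v) z" by (auto simp: is_path_append)
  show "X \<in> El (Cat M) \<and> Y \<in> El (Cat M) \<and> tgt (Cat M) X = src (Cat M) Y"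
    using * by (auto simp: Cat_El_iff Cat_src Cat_tgt)
  show "Z \<in> El (Cat M) \<and> src (Cat M) Z = src (Cat M) X \<and> tgt (Cat M) Z = tgt (Cat M) Y"
    using * ** by (auto simp: Cat_El_iff Cat_src Cat_tgt)
next
  fix X Y XY Z YZ assume "mul (Cat M) X Y = Some XY" "mul (Cat M) Y Z = Some YZ"
  from this(1) obtain x u y v z where 1: "is_path M x u y" "is_path M y v z"
    "X = cls x u y" "Y = cls y v z" "XY = cls x (u @ v) z" by (rule Cat_mul_cases)
  from \<open>mul (Cat M) Y Z = Some YZ\<close> obtain y' v' z' w t where
    2: "is_path M y' v' z'" "is_path M z' w t"
    "Y = cls y' v' z'" "Z = cls z' w t" "YZ = cls y' (v' @ w) t" by (rule Cat_mul_cases)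
  have yz: "y' = y" "z' = z"
    using 1 2 Cat_src[OF 1(2)] Cat_src[OF 2(1)] Cat_tgt[OF 1(2)] Cat_tgt[OF 2(1)] by auto
  have YZ: "YZ = cls y (v @ w) t"
    using Cat_mul[OF 1(2), of w t] \<open>mul (Cat M) Y Z = Some YZ\<close> 1 2 yz by auto
  have p: "is_path M x (u @ v) z" "is_path M y (v @ w) t"
    using 1 2 yz by (auto simp: is_path_append)
  show "mul (Cat M) XY Z = mul (Cat M) X YZ"
    using Cat_mul[OF p(1), of w t] Cat_mul[OF 1(1) p(2)] 1 2 yz YZ by simp
next
  fix X Y assume "X \<in> El (Cat M)" "Y \<in> El (Cat M)" and e: "tgt (Cat M) X = src (Cat M) Y"
  then obtain x u y y' v z where *: "is_path M x u y" "X = cls x u y"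
      "is_path M y' v z" "Y = cls y' v z"
    unfolding Cat_El_iff by blast
  with e have "y' = y" by (simp add: Cat_src Cat_tgt)
  with * show "\<exists>Z. mul (Cat M) X Y = Some Z" using Cat_mul[of x u y v z] by blast
qed

end


section \<open>Garside families and Garside germs\<close>

definition invertibles :: "('o, 'a) pmon \<Rightarrow> 'a set" where
  "invertibles C = {f \<in> El C. \<exists>g\<in>El C. mul C f g = Some (ident C (src C f))
                                   \<and> mul C g f = Some (ident C (tgt C f))}"

definition sharp :: "('o, 'a) pmon \<Rightarrow> 'a set \<Rightarrow> 'a set" where
  "sharp C S = {h. \<exists>s\<in>S. \<exists>e\<in>invertibles C. mul C s e = Some h} \<union> invertibles C"

fun path_prod :: "('o, 'a) pmon \<Rightarrow> 'a list \<Rightarrow> 'a option" where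
  "path_prod C [] = None"
| "path_prod C [g] = Some g"
| "path_prod C (g # h # gs) =
     (case path_prod C (h # gs) of None \<Rightarrow> None | Some k \<Rightarrow> mul C g k)"

definition normal_path :: "('o, 'a) pmon \<Rightarrow> 'a set \<Rightarrow> 'a list \<Rightarrow> bool" where
  "normal_path C S gs \<longleftrightarrow>
     gs \<noteq> [] \<and> set gs \<subseteq> sharp C S \<and>
     (\<forall>i. Suc i < length gs \<longrightarrow> tgt C (gs ! i) = src C (gs ! Suc i)) \<and>
     (\<forall>i. Suc i < length gs \<longrightarrow>
        (\<forall>a\<in>S. \<forall>f\<in>El C. \<forall>fg fgh.
           mul C f (gs ! i) = Some fg \<and> mul C fg (gs ! Suc i) = Some fgh \<and> ldiv C a fgh
           \<longrightarrow> ldiv C a fg))"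

definition garside_family :: "('o, 'a) pmon \<Rightarrow> 'a set \<Rightarrow> bool" where
  "garside_family C S \<longleftrightarrow>
     S \<subseteq> El C \<and> (\<forall>g\<in>El C. \<exists>gs. normal_path C S gs \<and> path_prod C gs = Some g)"

text \<open>
  This definition does not force the germ to be left-associative: if the presented category is a
  groupoid, every embedded germ qualifies, for instance \<open>{- 1, 0, 1}\<close> with the addition of the
  integers as far as it stays in the set. The criterion for Garside germs in terms of the sets
  \<open>JS M a1 a2\<close> concerns left-associative germs, that is, germs induced on Garside families that
  contain the identities and are closed under right-divisors.
\<close>

definition garside_germ :: "('o, 'a) pmon \<Rightarrow> bool" where
  "garside_germ M \<longleftrightarrow>
     inj_on (gen M) (El M) \<and> left_cancellative (Cat M) \<and>
     garside_family (Cat M) (gen M ` El M)"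


section \<open>Machine model\<close>

text \<open>
  Programs are executed on a machine with variables, one- and two-dimensional arrays, all holding
  natural numbers, with unit cost per elementary operation. The elements of the finite germ are
  given to a program as the numbers \<open>0, \<dots>, n - 1\<close>. The only arithmetic operation is the
  successor, so that nothing can be gained by packing data into large numbers, and the only loops
  are bounded ones, so that every program terminates. Programs being finite pieces of syntax,
  ``there is a program'' really asks for an algorithm.
\<close>

record coded =
  csize :: nat
  cdef :: "nat \<Rightarrow> nat \<Rightarrow> bool"
  cmul :: "nat \<Rightarrow> nat \<Rightarrow> nat"
  csrc :: "nat \<Rightarrow> nat"
  ctgt :: "nat \<Rightarrow> nat"

record state =
  var :: "string \<Rightarrow> nat"
  vec :: "string \<Rightarrow> nat \<Rightarrow> nat"
  tab :: "string \<Rightarrow> nat \<Rightarrow> nat \<Rightarrow> nat"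

datatype exp =
    Const nat
  | V string
  | Vec string exp
  | Tab string exp exp
  | SUC exp
  | Size
  | Mul exp exp
  | Src exp
  | Tgt exp

datatype bexp =
    Defd exp exp
  | Eq exp exp
  | Less exp exp
  | Neg bexp
  | Conj bexp bexp

datatype com =
    Skip
  | Assign string exp  ("_ ::= _" [1000, 61] 61)
  | SetVec string exp exp
  | SetTab string exp exp exp
  | Seq com com  (infixr ";;" 60)
  | Cond bexp com com  ("(IF _/ THEN _/ ELSE _)" [0, 0, 61] 61)
  | For string exp com  ("(FOR _ < _/ DO _)" [1000, 0, 61] 61)
  | Return exp

abbreviation When :: "bexp \<Rightarrow> com \<Rightarrow> com"  ("(WHEN _/ DO _)" [0, 61] 61) where
  "WHEN b DO c \<equiv> IF b THEN c ELSE Skip"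

primrec eval :: "coded \<Rightarrow> state \<Rightarrow> exp \<Rightarrow> nat" where
  "eval M s (Const k) = k"
| "eval M s (V x) = var s x"
| "eval M s (Vec x e) = vec s x (eval M s e)"
| "eval M s (Tab x e1 e2) = tab s x (eval M s e1) (eval M s e2)"
| "eval M s (SUC e) = Suc (eval M s e)"
| "eval M s Size = csize M"
| "eval M s (Mul e1 e2) = cmul M (eval M s e1) (eval M s e2)"
| "eval M s (Src e) = csrc M (eval M s e)"
| "eval M s (Tgt e) = ctgt M (eval M s e)"

primrec beval :: "coded \<Rightarrow> state \<Rightarrow> bexp \<Rightarrow> bool" where
  "beval M s (Defd e1 e2) \<longleftrightarrow> cdef M (eval M s e1) (eval M s e2)"
| "beval M s (Eq e1 e2) \<longleftrightarrow> eval M s e1 = eval M s e2"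
| "beval M s (Less e1 e2) \<longleftrightarrow> eval M s e1 < eval M s e2"
| "beval M s (Neg b) \<longleftrightarrow> \<not> beval M s b"
| "beval M s (Conj b1 b2) \<longleftrightarrow> beval M s b1 \<and> beval M s b2"

text \<open>\<open>\<kappa>\<close> is the time needed for one evaluation of the partial operation \<open>\<bullet>\<close>.\<close>

primrec ecost :: "nat \<Rightarrow> exp \<Rightarrow> nat" where
  "ecost \<kappa> (Const k) = 1"
| "ecost \<kappa> (V x) = 1"
| "ecost \<kappa> (Vec x e) = 1 + ecost \<kappa> e"
| "ecost \<kappa> (Tab x e1 e2) = 1 + ecost \<kappa> e1 + ecost \<kappa> e2"
| "ecost \<kappa> (SUC e) = 1 + ecost \<kappa> e"
| "ecost \<kappa> Size = 1"
| "ecost \<kappa> (Mul e1 e2) = 1 + \<kappa> + ecost \<kappa> e1 + ecost \<kappa> e2"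
| "ecost \<kappa> (Src e) = 1 + ecost \<kappa> e"
| "ecost \<kappa> (Tgt e) = 1 + ecost \<kappa> e"

primrec bcost :: "nat \<Rightarrow> bexp \<Rightarrow> nat" where
  "bcost \<kappa> (Defd e1 e2) = 1 + \<kappa> + ecost \<kappa> e1 + ecost \<kappa> e2"
| "bcost \<kappa> (Eq e1 e2) = 1 + ecost \<kappa> e1 + ecost \<kappa> e2"
| "bcost \<kappa> (Less e1 e2) = 1 + ecost \<kappa> e1 + ecost \<kappa> e2"
| "bcost \<kappa> (Neg b) = 1 + bcost \<kappa> b"
| "bcost \<kappa> (Conj b1 b2) = 1 + bcost \<kappa> b1 + bcost \<kappa> b2"

text \<open>
  The outcome of a command consists of the final state, the returned value (\<open>None\<close> as long as no
  \<open>Return\<close> has been executed, \<open>Some\<close> stops the program), and the running time.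
\<close>

type_synonym outcome = "state \<times> nat option \<times> nat"

fun and_then :: "outcome \<Rightarrow> (state \<Rightarrow> outcome) \<Rightarrow> outcome" where
  "and_then (s, Some v, t) f = (s, Some v, t)"
| "and_then (s, None, t) f = (case f s of (s', r, t') \<Rightarrow> (s', r, t + t'))"

text \<open>\<open>iterate f i k\<close> runs \<open>f i\<close>, \dots, \<open>f (i + k - 1)\<close> in this order.\<close>

primrec iterate :: "(nat \<Rightarrow> state \<Rightarrow> outcome) \<Rightarrow> nat \<Rightarrow> nat \<Rightarrow> state \<Rightarrow> outcome" where
  "iterate f i 0 s = (s, None, 1)"
| "iterate f i (Suc k) s =
     and_then (s, None, 1) (\<lambda>s. and_then (f i s) (iterate f (Suc i) k))"

primrec exec :: "nat \<Rightarrow> coded \<Rightarrow> com \<Rightarrow> state \<Rightarrow> outcome" where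
  "exec \<kappa> M Skip s = (s, None, 1)"
| "exec \<kappa> M (x ::= e) s =
     (s\<lparr>var := (var s)(x := eval M s e)\<rparr>, None, 1 + ecost \<kappa> e)"
| "exec \<kappa> M (SetVec x e1 e) s =
     (s\<lparr>vec := (vec s)(x := (vec s x)(eval M s e1 := eval M s e))\<rparr>, None,
      1 + ecost \<kappa> e1 + ecost \<kappa> e)"
| "exec \<kappa> M (SetTab x e1 e2 e) s =
     (s\<lparr>tab := (tab s)(x := (tab s x)(eval M s e1 :=
        (tab s x (eval M s e1))(eval M s e2 := eval M s e)))\<rparr>, None,
      1 + ecost \<kappa> e1 + ecost \<kappa> e2 + ecost \<kappa> e)"
| "exec \<kappa> M (c1 ;; c2) s = and_then (exec \<kappa> M c1 s) (exec \<kappa> M c2)"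
| "exec \<kappa> M (IF b THEN c1 ELSE c2) s =
     and_then (s, None, 1 + bcost \<kappa> b)
       (\<lambda>s. if beval M s b then exec \<kappa> M c1 s else exec \<kappa> M c2 s)"
| "exec \<kappa> M (FOR x < e DO c) s =
     and_then (s, None, 1 + ecost \<kappa> e)
       (iterate (\<lambda>i s. exec \<kappa> M c (s\<lparr>var := (var s)(x := i)\<rparr>)) 0 (eval M s e))"
| "exec \<kappa> M (Return e) s = (s, Some (eval M s e), 1 + ecost \<kappa> e)"


section \<open>Coding of finite germs\<close>

definition enumerates :: "'a list \<Rightarrow> ('o, 'a) pmon \<Rightarrow> bool" where
  "enumerates es M \<longleftrightarrow> distinct es \<and> set es = El M"

definition index :: "'a list \<Rightarrow> 'a \<Rightarrow> nat" where
  "index es a = (THE i. i < length es \<and> es ! i = a)"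

text \<open>
  An object \<open>x\<close> is coded by the code of its distinguished element \<open>1\<^sub>x\<close>. Operations applied to
  numbers that are no codes yield dummy values.
\<close>

definition code :: "('o, 'a) pmon \<Rightarrow> 'a list \<Rightarrow> coded" where
  "code M es =
     \<lparr> csize = length es,
       cdef = (\<lambda>i j. i < length es \<and> j < length es \<and> (\<exists>c. mul M (es ! i) (es ! j) = Some c)),
       cmul = (\<lambda>i j. if i < length es \<and> j < length es
                 then (case mul M (es ! i) (es ! j) of None \<Rightarrow> 0 | Some c \<Rightarrow> index es c) else 0),
       csrc = (\<lambda>i. if i < length es then index es (ident M (src M (es ! i))) else 0),
       ctgt = (\<lambda>i. if i < length es then index es (ident M (tgt M (es ! i))) else 0) \<rparr>"

text \<open>
  The table of truth values of the left-divisibility relation is kept in the array \<open>D\<close>, the list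
  \<open>S'\<close> in the first \<open>len\<close> cells of the array \<open>L\<close>.
\<close>

definition holds_table :: "('o, 'a) pmon \<Rightarrow> 'a list \<Rightarrow> state \<Rightarrow> bool" where
  "holds_table M es s \<longleftrightarrow>
     (\<forall>i<length es. \<forall>j<length es. tab s ''D'' i j = of_bool (ldiv M (es ! i) (es ! j)))"

definition holds_list :: "'a list \<Rightarrow> 'a list \<Rightarrow> state \<Rightarrow> bool" where
  "holds_list es as s \<longleftrightarrow>
     var s ''len'' = length as \<and> (\<forall>i<length as. vec s ''L'' i = index es (as ! i))"


section \<open>The functions\<close>

text \<open>The truth values returned are 1 (true) and 0 (false).\<close>

definition IsLeftAssociative :: com where
  "IsLeftAssociative =
     FOR ''a'' < Size DO
       FOR ''b'' < Size DO
         WHEN Eq (Tgt (V ''a'')) (Src (V ''b'')) DO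
           FOR ''c'' < Size DO
             WHEN Conj (Eq (Tgt (V ''b'')) (Src (V ''c'')))
                    (Conj (Conj (Defd (V ''a'') (V ''b'')) (Defd (Mul (V ''a'') (V ''b'')) (V ''c'')))
                         (Neg (Defd (V ''b'') (V ''c'')))) DO
               Return (Const 0) ;;
     Return (Const 1)"

definition LeftDivisibility :: com where
  "LeftDivisibility =
     FOR ''a'' < Size DO (
       FOR ''b'' < Size DO
         SetTab ''D'' (V ''a'') (V ''b'') (Const 0) ;;
       FOR ''b'' < Size DO
         WHEN Defd (V ''a'') (V ''b'') DO
           IF Eq (Tab ''D'' (V ''a'') (Mul (V ''a'') (V ''b''))) (Const 1)
           THEN Return (Const 0)
           ELSE SetTab ''D'' (V ''a'') (Mul (V ''a'') (V ''b'')) (Const 1)) ;;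
     Return (Const 1)"

text \<open>
  In \<open>NonAscending\<close> the first inner loop determines the position \<open>pos\<close> of insertion, and the
  second one inserts \<open>a\<close> there, moving the later entries by one cell.
\<close>

definition NonAscending :: com where
  "NonAscending =
     ''len'' ::= Const 0 ;;
     FOR ''a'' < Size DO (
       ''pos'' ::= V ''len'' ;;
       ''found'' ::= Const 0 ;;
       FOR ''i'' < V ''len'' DO
         WHEN Conj (Eq (V ''found'') (Const 0))
                (Conj (Eq (Tab ''D'' (Vec ''L'' (V ''i'')) (V ''a'')) (Const 1))
                     (Neg (Eq (Tab ''D'' (V ''a'') (Vec ''L'' (V ''i''))) (Const 1)))) DO (
           ''pos'' ::= V ''i'' ;;
           ''found'' ::= Const 1) ;;
       ''cur'' ::= V ''a'' ;;
       FOR ''i'' < SUC (V ''len'') DO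
         WHEN Neg (Less (V ''i'') (V ''pos'')) DO (
           ''next'' ::= Vec ''L'' (V ''i'') ;;
           SetVec ''L'' (V ''i'') (V ''cur'') ;;
           ''cur'' ::= V ''next'') ;;
       ''len'' ::= SUC (V ''len''))"

definition JHasGreatestElement :: com where
  "JHasGreatestElement =
     ''found'' ::= Const 0 ;;
     FOR ''i'' < V ''len'' DO (
       ''b'' ::= Vec ''L'' (V ''i'') ;;
       WHEN Conj (Defd (V ''a1'') (V ''b'')) (Eq (Tab ''D'' (V ''b'') (V ''a2'')) (Const 1)) DO
         IF Eq (V ''found'') (Const 0)
         THEN (''c'' ::= V ''b'' ;; ''found'' ::= Const 1)
         ELSE WHEN Neg (Eq (Tab ''D'' (V ''b'') (V ''c'')) (Const 1)) DO
           Return (Const 0)) ;;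
     Return (Const 1)"

end

theory Submission
  imports Defs
begin

text \<open>
  The first four parts are about the four given programs. Each of them is verified by loop
  invariants, together with a time bound whose order is the nesting depth of its loops. Two of the
  invariants rest on mathematical facts, both for transitive divisibility. Inserting \<open>a\<close> before the first entry strictly
  below it keeps a list non-ascending, because an entry behind \<open>a\<close> that were strictly above \<open>a\<close>
  would also be strictly above that entry (\<open>non_ascending_insert\<close>). And in a non-ascending list
  the first entry lying in \<open>JS M a1 a2\<close> must be greatest there if there is a greatest element at
  all (\<open>first_entry_greatest\<close>), so that a single pass suffices.

  The last part needs a criterion that only involves the germ itself: a left-associative germ is a
  Garside germ if and only if it is left-cancellative and each of the sets \<open>JS M a1 a2\<close> of a
  composable pair has a greatest element (\<open>left_associative_garside_germ_iff\<close>). Running the four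
  algorithms one after the other, the last of them for every composable pair, then takes cubic
  time.

  In the criterion, left-associativity makes the germ embed in its category in such a way that
  local divisibility is the restriction of divisibility in the category: evaluating a path from the
  right gives a partial map that is constant on congruence classes (\<open>path_val_cong\<close>). If the germ
  is a Garside germ, the first entry of a normal decomposition of \<open>a\<^sub>1 a\<^sub>2\<close> yields a greatest
  element of the germ dividing \<open>a\<^sub>1 a\<^sub>2\<close>, of the form \<open>a\<^sub>1 \<bullet> c\<close>, and \<open>c\<close> is the greatest element
  of \<open>JS M a1 a2\<close>. Conversely, greatest elements allow one to compute, from the right end of a path,
  a head in the germ and a tail. Up to invertible factors, head and tail depend on the class of the
  path only (\<open>hdec_cong\<close>). It follows that the head is a greatest element of the germ dividing the
  path, that the category is left-cancellative (\<open>pcong_cancel\<close>), and, by splitting off heads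
  repeatedly, that every element has a normal decomposition (\<open>heads_ex\<close>, \<open>heads_normal\<close>). The
  splitting ends because the tail can be chosen shorter than the path.
\<close>

section \<open>Left-associative germs in their categories\<close>

definition greatest_J :: "('o, 'a) pmon \<Rightarrow> bool" where
  "greatest_J M \<longleftrightarrow> (\<forall>a1\<in>El M. \<forall>a2\<in>El M. tgt M a1 = src M a2 \<longrightarrow>
     (\<exists>c. is_greatest M (JS M a1 a2) c))"

text \<open>
  Products inside the germ are formed from the right, because left-associativity carries
  definedness from a product to its right factors: the end of a path that has a value has a value.
\<close>

fun path_val :: "('o, 'a) pmon \<Rightarrow> 'o \<Rightarrow> 'a list \<Rightarrow> 'a option" where
  "path_val M y [] = Some (ident M y)"
| "path_val M y (a # w) = (case path_val M y w of None \<Rightarrow> None | Some b \<Rightarrow> mul M a b)"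

declare pcong_trans [trans]

context germ
begin

lemma ldiv_refl: "a \<in> El M \<Longrightarrow> ldiv M a a"
  unfolding ldiv_def using mul_ident ident_El tgt_Ob by blast

lemma ldivI: "mul M a b = Some c \<Longrightarrow> ldiv M a c"
  unfolding ldiv_def using mul_dom by blast

lemma is_path_single [simp]: "a \<in> El M \<Longrightarrow> is_path M (src M a) [a] (tgt M a)"
  by (simp add: tgt_Ob)

lemma pcong_mul_Cons:
  assumes "mul M a b = Some c" "is_path M (tgt M b) v y"
  shows "pcong M (src M a) y (a # b # v) (c # v)"
  using pcong.pcong_mul[of M "src M a" "[]" a b v y c] assms mul_dom[OF assms(1)] by simp

lemma pcong_ident_Cons:
  assumes "is_path M x v y"
  shows "pcong M x y (ident M x # v) v"
proof -
  have x: "x \<in> Ob M" using is_path_Ob[OF assms] by simp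
  show ?thesis
    using pcong.pcong_ident[of M x "[]" x v y] assms x by (simp add: ident_El src_ident tgt_ident)
qed

lemma pcong_Cons:
  assumes "pcong M (tgt M a) y u v" "a \<in> El M"
  shows "pcong M (src M a) y (a # u) (a # v)"
  using pcong_append[OF pcong_refl[OF is_path_single[OF assms(2)]] assms(1)] by simp

lemma path_val_append_cong:
  "path_val M y v = path_val M y v' \<Longrightarrow> path_val M y (u @ v) = path_val M y (u @ v')"
  by (induction u) auto

lemma path_val_single: "a \<in> El M \<Longrightarrow> path_val M (tgt M a) [a] = Some a"
  by (simp add: mul_ident)

lemma path_val_pcong:
  "is_path M x w y \<Longrightarrow> path_val M y w = Some b \<Longrightarrow>
     b \<in> El M \<and> src M b = x \<and> tgt M b = y \<and> pcong M x y w [b]"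
proof (induction w arbitrary: x b)
  case Nil
  then have "pcong M y y [ident M y] []" by (intro pcong_ident_Cons) auto
  with Nil show ?case by (auto simp: ident_El src_ident tgt_ident intro: pcong_sym)
next
  case (Cons a w)
  then obtain e where e: "path_val M y w = Some e" "mul M a e = Some b"
    by (auto split: option.splits)
  have w: "is_path M (tgt M a) w y" "a \<in> El M" "x = src M a" using Cons.prems by auto
  note IH = Cons.IH[OF w(1) e(1)]
  have "pcong M x y (a # w) [a, e]" unfolding w(3) using IH w by (intro pcong_Cons) auto
  moreover have "pcong M x y [a, e] [b]"
    unfolding w(3) using IH e by (intro pcong_mul_Cons) (auto simp: tgt_Ob)
  ultimately show ?case
    using mul_cod[OF e(2)] w IH by (auto intro: pcong_trans)
qed

end

locale left_assoc_germ = germ +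
  assumes left_assoc: "left_associative M"
begin

lemma mul_right_assoc:
  assumes "mul M a b = Some ab" "mul M ab c = Some d"
  obtains bc where "mul M b c = Some bc" "mul M a bc = Some d"
  using assms left_assoc mul_assoc unfolding left_associative_def by metis

lemma mul_left_assoc:
  assumes "mul M a b = Some ab" "mul M b c = Some bc" "mul M a bc = Some d"
  shows "mul M ab c = Some d"
  using mul_assoc[OF assms(1,2)] assms(3) by simp

lemma ldiv_trans: "ldiv M a b \<Longrightarrow> ldiv M b c \<Longrightarrow> ldiv M a c"
  using left_associative_imp_transp_ldiv[OF germ_axioms left_assoc] by (blast dest: transpD)

text \<open>
  The key to the embedding of the germ into its category: left-associativity and the germ axiom
  make both sides of a relation \<open>a b = a \<bullet> b\<close> act in the same way on the value of the path behind
  them, including whether the result is defined.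
\<close>

lemma path_val_cong: "pcong M x y u v \<Longrightarrow> path_val M y u = path_val M y v"
proof (induction rule: pcong.induct)
  case (pcong_mul u a b v c)
  have "path_val M y ([a, b] @ v) = path_val M y ([c] @ v)"
  proof (cases "path_val M y v")
    case (Some e)
    have "(case mul M b e of None \<Rightarrow> None | Some d \<Rightarrow> mul M a d) = mul M c e"
    proof (cases "mul M b e")
      case None
      then have "mul M c e = None"
        using mul_right_assoc[OF pcong_mul.hyps(2), of e] by (cases "mul M c e") force+
      with None show ?thesis by simp
    next
      case (Some d)
      then show ?thesis using mul_assoc[OF pcong_mul.hyps(2) Some] by simp
    qed
    with Some show ?thesis by simp
  qed simp
  then show ?case by (rule path_val_append_cong)
next
  case (pcong_ident u z v)
  then have v: "is_path M z v y" by (auto simp: is_path_append tgt_ident)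
  have "path_val M y ([ident M z] @ v) = path_val M y v"
  proof (cases "path_val M y v")
    case (Some e)
    then show ?thesis using path_val_pcong[OF v Some] ident_mul[of e] by simp
  qed simp
  then show ?case by (rule path_val_append_cong)
qed auto

lemma pcong_single_cases:
  assumes "pcong M x y [a] (u @ v)" "is_path M z v y"
  obtains b c where "path_val M y v = Some b" "pcong M z y v [b]" "path_val M y (u @ [b]) = Some a"
proof -
  have a: "a \<in> El M" "src M a = x" "tgt M a = y" using pcong_is_path[OF assms(1)] by auto
  then have val: "path_val M y (u @ v) = Some a"
    using path_val_cong[OF assms(1)] path_val_single[OF a(1)] by simp
  then have "path_val M y v \<noteq> None"
    by (induction u arbitrary: a) (auto split: option.splits)
  then obtain b where b: "path_val M y v = Some b" by blast
  note bv = path_val_pcong[OF assms(2) b]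
  have "path_val M y (u @ [b]) = path_val M y (u @ v)"
    using bv path_val_single[of b] b by (intro path_val_append_cong) auto
  with b bv val that show ?thesis by auto
qed

text \<open>
  The value \<open>b\<close> of \<open>v\<close> exists because \<open>s v\<close> has the value \<open>a\<close>, and then \<open>s \<bullet> b = a\<close>. Hence
  divisibility between elements of the germ is the same in the category and in the germ.
\<close>

lemma pcong_single_ldiv:
  assumes "pcong M x y [a] (s # v)"
  shows "ldiv M s a"
proof -
  have v: "is_path M (tgt M s) v y" using pcong_is_path[OF assms] by simp
  obtain b where "path_val M y v = Some b" "path_val M y ([s] @ [b]) = Some a"
    using pcong_single_cases[of x y a "[s]" v] assms v by auto
  moreover from this(1) have "path_val M y [b] = Some b"
    using path_val_pcong[OF v] path_val_single[of b] by auto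
  ultimately show ?thesis by (auto intro: ldivI)
qed

end


section \<open>Heads\<close>

text \<open>
  In \<open>hdec M y w h t\<close>, the path \<open>w\<close> with target \<open>y\<close> is equal to \<open>h\<close> followed by \<open>t\<close>, and \<open>h\<close> will
  turn out to be a greatest element of the germ dividing \<open>w\<close>. When \<open>a\<close> is put in front of \<open>w\<close>,
  the largest possible part \<open>c\<close> of \<open>h\<close> moves over to \<open>a\<close>, and the rest \<open>d\<close> of \<open>h\<close> is left to the
  tail. This is a relation and not a function since \<open>c\<close> is unique up to an invertible factor only.
\<close>

inductive hdec :: "('o, 'a) pmon \<Rightarrow> 'o \<Rightarrow> 'a list \<Rightarrow> 'a \<Rightarrow> 'a list \<Rightarrow> bool" for M y where
  hdec_Nil: "y \<in> Ob M \<Longrightarrow> hdec M y [] (ident M y) []"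
| hdec_Cons: "hdec M y w h t \<Longrightarrow> is_greatest M (JS M a h) c \<Longrightarrow> mul M c d = Some h
    \<Longrightarrow> mul M a c = Some k \<Longrightarrow> hdec M y (a # w) k (d # t)"

inductive_cases hdec_NilE: "hdec M y [] h t"
inductive_cases hdec_ConsE: "hdec M y (a # w) h t"

text \<open>
  The preorder on pairs of a head and a tail whose associated equivalence relation consists in
  shifting an invertible factor. Working with one direction at a time avoids mentioning inverses.
\<close>

definition shift :: "('o, 'a) pmon \<Rightarrow> 'o \<Rightarrow> 'a \<Rightarrow> 'a list \<Rightarrow> 'a \<Rightarrow> 'a list \<Rightarrow> bool" where
  "shift M y h t h' t' \<longleftrightarrow>
     (\<exists>e. mul M h e = Some h' \<and> is_path M (tgt M h') t' y \<and> pcong M (tgt M h) y t (e # t'))"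

locale J_germ = left_assoc_germ +
  assumes left_canc: "left_cancellative M"
    and greatest: "greatest_J M"
begin

lemma cancel: "mul M a b = Some c \<Longrightarrow> mul M a b' = Some c \<Longrightarrow> b = b'"
  using left_canc unfolding left_cancellative_def by blast

lemma JS_iff: "b \<in> JS M a h \<longleftrightarrow> (\<exists>k. mul M a b = Some k) \<and> ldiv M b h"
  unfolding JS_def using mul_dom by blast

lemma hdec_path:
  "hdec M y w h t \<Longrightarrow> h \<in> El M \<and> is_path M (src M h) w y \<and> is_path M (tgt M h) t y
     \<and> pcong M (src M h) y w (h # t)"
proof (induction rule: hdec.induct)
  case hdec_Nil
  then show ?case
    using pcong_ident_Cons[of y "[]" y]
    by (auto simp: ident_El src_ident tgt_ident intro: pcong_sym)
next
  case (hdec_Cons w h t a c d k)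
  note ac = mul_dom[OF hdec_Cons(4)] mul_cod[OF hdec_Cons(4)]
  note cd = mul_dom[OF hdec_Cons(3)] mul_cod[OF hdec_Cons(3)]
  have "pcong M (src M a) y (a # w) (a # h # t)"
    using hdec_Cons.IH ac cd by (intro pcong_Cons) auto
  also have "pcong M (src M a) y \<dots> (a # c # d # t)"
    using hdec_Cons.IH hdec_Cons.hyps ac cd
    by (intro pcong_Cons) (auto intro!: pcong_sym[OF pcong_mul_Cons])
  also have "pcong M (src M a) y \<dots> (k # d # t)"
    using hdec_Cons.IH hdec_Cons.hyps ac cd by (intro pcong_mul_Cons) auto
  finally show ?case using ac cd hdec_Cons.IH by auto
qed

lemma hdec_step_ex:
  assumes "a \<in> El M" "h \<in> El M" "tgt M a = src M h"
  obtains c d k where "is_greatest M (JS M a h) c" "mul M c d = Some h" "mul M a c = Some k"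
proof -
  obtain c where c: "is_greatest M (JS M a h) c"
    using greatest assms unfolding greatest_J_def by blast
  then have "c \<in> JS M a h" by (simp add: is_greatest_def)
  then show ?thesis using that[OF c] by (auto simp: JS_iff ldiv_def)
qed

lemma hdec_ex: "is_path M x w y \<Longrightarrow> \<exists>h t. hdec M y w h t"
proof (induction w arbitrary: x)
  case Nil
  then show ?case by (auto intro: hdec_Nil)
next
  case (Cons a w)
  then obtain h t where h: "hdec M y w h t" using Cons.IH[of "tgt M a"] by auto
  have "src M h = tgt M a"
    using hdec_path[OF h] Cons.prems by (cases w) auto
  then obtain c d k where "is_greatest M (JS M a h) c" "mul M c d = Some h" "mul M a c = Some k"
    using hdec_step_ex[of a h] hdec_path[OF h] Cons.prems by auto
  from hdec_Cons[OF h this] show ?case by blast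
qed

lemma shift_refl: "h \<in> El M \<Longrightarrow> is_path M (tgt M h) t y \<Longrightarrow> shift M y h t h t"
  unfolding shift_def using mul_ident[of h] pcong_sym[OF pcong_ident_Cons, of "tgt M h" t y] by auto

lemma shift_trans:
  assumes "shift M y h t h' t'" "shift M y h' t' h'' t''"
  shows "shift M y h t h'' t''"
proof -
  obtain e where e: "mul M h e = Some h'" "pcong M (tgt M h) y t (e # t')"
    using assms(1) by (auto simp: shift_def)
  obtain f where f: "mul M h' f = Some h''" "is_path M (tgt M h'') t'' y"
    "pcong M (tgt M h') y t' (f # t'')"
    using assms(2) by (auto simp: shift_def)
  obtain g where g: "mul M e f = Some g" "mul M h g = Some h''"
    using mul_right_assoc[OF e(1) f(1)] .
  note d = mul_dom[OF e(1)] mul_cod[OF e(1)] mul_dom[OF f(1)] mul_cod[OF f(1)]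
  note e(2)
  also have "pcong M (tgt M h) y (e # t') (e # f # t'')"
    using pcong_Cons[of e y t' "f # t''"] d f(3) by simp
  also have "pcong M (tgt M h) y \<dots> (g # t'')"
    using pcong_mul_Cons[OF g(1), of t'' y] d f(2) by simp
  finally have "pcong M (tgt M h) y t (g # t'')" .
  with g f(2) show ?thesis by (auto simp: shift_def)
qed

lemma shift_ldiv: "shift M y h t h' t' \<Longrightarrow> ldiv M h h'"
  unfolding shift_def by (auto intro: ldivI)

text \<open>
  With \<open>f\<close> the factor that is shifted, \<open>c \<bullet> (d \<bullet> f)\<close> and \<open>c \<bullet> (e \<bullet> d')\<close> both equal \<open>h'\<close>, so that \<open>c\<close>
  can be cancelled inside the germ. This is how congruences of tails are obtained before left
  cancellation is known in the category.
\<close>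

lemma shift_tail:
  assumes sh: "shift M y h t h' t'"
    and c: "mul M c d = Some h" "mul M c e = Some c'" "mul M c' d' = Some h'"
  shows "pcong M (tgt M c) y (d # t) (e # d' # t')"
proof -
  obtain f where f: "mul M h f = Some h'" "is_path M (tgt M h') t' y"
    "pcong M (tgt M h) y t (f # t')"
    using sh by (auto simp: shift_def)
  obtain df where df: "mul M d f = Some df" "mul M c df = Some h'"
    using mul_right_assoc[OF c(1) f(1)] .
  obtain ed where ed: "mul M e d' = Some ed" "mul M c ed = Some h'"
    using mul_right_assoc[OF c(2,3)] .
  have eq: "df = ed" using cancel df(2) ed(2) by blast
  note doms = mul_dom[OF c(1)] mul_cod[OF c(1)] mul_dom[OF c(2)] mul_dom[OF c(3)] mul_cod[OF c(3)]
    mul_dom[OF f(1)] mul_cod[OF f(1)]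
  have "pcong M (tgt M c) y (d # t) (d # f # t')"
    using pcong_Cons[of d y t "f # t'"] doms f(3) by simp
  also have "pcong M (tgt M c) y \<dots> (df # t')"
    using pcong_mul_Cons[OF df(1), of t' y] doms f(2) by simp
  also have "pcong M (tgt M c) y \<dots> (e # d' # t')"
    using pcong_mul_Cons[OF ed(1), of t' y] doms f(2) eq by (auto intro: pcong_sym)
  finally show ?thesis .
qed

text \<open>
  A larger head leaves more room for the part that moves over to \<open>a\<close>: \<open>JS M a h\<close> is contained in
  \<open>JS M a h'\<close>, and the greatest elements are related accordingly.
\<close>

lemma shift_step:
  assumes sh: "shift M y h t h' t'"
    and c: "is_greatest M (JS M a h) c" "mul M c d = Some h" "mul M a c = Some k"
    and c': "is_greatest M (JS M a h') c'" "mul M c' d' = Some h'" "mul M a c' = Some k'"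
  shows "shift M y k (d # t) k' (d' # t')"
proof -
  have "c \<in> JS M a h'"
    using c(3) ldiv_trans[OF ldivI[OF c(2)] shift_ldiv[OF sh]] by (auto simp: JS_iff)
  then obtain e where e: "mul M c e = Some c'"
    using c'(1) by (auto simp: is_greatest_def ldiv_def)
  have "mul M k e = Some k'" by (rule mul_left_assoc[OF c(3) e c'(3)])
  moreover have "pcong M (tgt M k) y (d # t) (e # d' # t')"
    using shift_tail[OF sh c(2) e c'(2)] mul_cod[OF c(3)] by simp
  ultimately show ?thesis
    using mul_cod[OF c(3)] mul_cod[OF c'(3)] pcong_is_path[OF shift_tail[OF sh c(2) e c'(2)]]
      mul_dom[OF e] mul_cod[OF e] by (auto simp: shift_def)
qed

text \<open>Putting an identity in front changes nothing: here \<open>c\<close> is equivalent to \<open>h\<close> itself.\<close>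

lemma shift_ident:
  assumes "is_path M (tgt M h) t y" "is_greatest M (JS M (ident M (src M h)) h) c"
    "mul M c d = Some h" "mul M (ident M (src M h)) c = Some k"
  shows "shift M y k (d # t) h t \<and> shift M y h t k (d # t)"
proof -
  have h: "h \<in> El M" using mul_cod[OF assms(3)] by simp
  have "src M c = src M h" "c \<in> El M" using mul_dom[OF assms(3)] mul_cod[OF assms(3)] by auto
  then have k: "k = c" using ident_mul[of c] assms(4) by simp
  have 1: "shift M y k (d # t) h t"
    unfolding shift_def using assms(1,3) mul_dom[OF assms(3)] mul_cod[OF assms(3)] k
    by (auto intro!: exI[of _ d] pcong_refl)
  have "h \<in> JS M (ident M (src M h)) h"
    using ident_mul[OF h] ldiv_refl[OF h] by (auto simp: JS_iff)
  then obtain e where e: "mul M h e = Some c"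
    using assms(2) by (auto simp: is_greatest_def ldiv_def)
  note pcong_sym[OF pcong_ident_Cons[OF assms(1)]]
  also have "pcong M (tgt M h) y (ident M (tgt M h) # t) (e # d # t)"
    by (rule shift_tail[OF shift_refl[OF h assms(1)] mul_ident[OF h] e assms(3)])
  finally have "pcong M (tgt M h) y t (e # d # t)" .
  then have "shift M y h t k (d # t)"
    using e k assms(1) mul_dom[OF assms(3)] mul_cod[OF assms(3)] by (auto simp: shift_def)
  with 1 show ?thesis ..
qed

text \<open>
  Putting \<open>b\<close> and then \<open>a\<close> in front amounts to putting \<open>a \<bullet> b\<close> in front: the part of \<open>b \<bullet> c\<close> that
  \<open>a\<close> takes is of the form \<open>b \<bullet> z\<close>, since \<open>a \<bullet> (b \<bullet> c'')\<close> is defined for the part \<open>c''\<close> of \<open>h\<close>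
  that \<open>a \<bullet> b\<close> takes. Then \<open>z\<close> and \<open>c''\<close> are equivalent.
\<close>

lemma shift_mul:
  assumes t: "is_path M (tgt M h) t y" and ab: "mul M a b = Some ab"
    and c: "is_greatest M (JS M b h) c" "mul M c d = Some h" "mul M b c = Some k"
    and c': "is_greatest M (JS M a k) c'" "mul M c' d' = Some k" "mul M a c' = Some k'"
    and c'': "is_greatest M (JS M ab h) c''" "mul M c'' d'' = Some h" "mul M ab c'' = Some k''"
  shows "shift M y k' (d' # d # t) k'' (d'' # t) \<and> shift M y k'' (d'' # t) k' (d' # d # t)"
proof -
  obtain bc'' where bc'': "mul M b c'' = Some bc''" "mul M a bc'' = Some k''"
    using mul_right_assoc[OF ab c''(3)] .
  have "c'' \<in> JS M b h" using bc''(1) ldivI[OF c''(2)] by (auto simp: JS_iff)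
  then obtain u where u: "mul M c'' u = Some c" using c(1) by (auto simp: is_greatest_def ldiv_def)
  have "mul M bc'' u = Some k" by (rule mul_left_assoc[OF bc''(1) u c(3)])
  then have "bc'' \<in> JS M a k" using bc''(2) ldivI by (auto simp: JS_iff)
  then obtain x where x: "mul M bc'' x = Some c'" using c'(1) by (auto simp: is_greatest_def ldiv_def)
  obtain z where z: "mul M c'' x = Some z" "mul M b z = Some c'"
    using mul_right_assoc[OF bc''(1) x] .
  obtain zd where zd: "mul M z d' = Some zd" "mul M b zd = Some k"
    using mul_right_assoc[OF z(2) c'(2)] .
  have zd': "mul M z d' = Some c" using zd cancel[OF zd(2) c(3)] by simp
  obtain dd where dd: "mul M d' d = Some dd" "mul M z dd = Some h"
    using mul_right_assoc[OF zd' c(2)] .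
  have abz: "mul M ab z = Some k'" by (rule mul_left_assoc[OF ab z(2) c'(3)])
  then have "z \<in> JS M ab h" using ldivI[OF dd(2)] by (auto simp: JS_iff)
  then obtain v where v: "mul M z v = Some c''" using c''(1) by (auto simp: is_greatest_def ldiv_def)
  have h: "h \<in> El M" using mul_cod[OF c(2)] by simp
  note sh = shift_refl[OF h t]
  have path: "is_path M (tgt M z) (d' # d # t) y" "is_path M (tgt M c'') (d'' # t) y"
    using t mul_dom[OF zd'] mul_dom[OF dd(1)] mul_cod[OF c(2)]
      mul_dom[OF c''(2)] mul_cod[OF c''(2)] by simp_all
  have k: "tgt M k' = tgt M z" "tgt M k'' = tgt M c''"
    using mul_cod[OF abz] mul_cod[OF c''(3)] by simp_all
  have x_El: "x \<in> El M" "src M x = tgt M c''" "tgt M x = tgt M z"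
    using mul_dom[OF z(1)] mul_cod[OF z(1)] by simp_all
  have tail: "pcong M (tgt M z) y (d' # d # t) (dd # t)"
    using pcong_mul_Cons[OF dd(1), of t y] mul_dom[OF zd'] t mul_cod[OF c(2)] by simp
  have "pcong M (tgt M z) y (d' # d # t) (v # d'' # t)"
    by (rule pcong_trans[OF tail shift_tail[OF sh dd(2) v c''(2)]])
  moreover have "mul M k' v = Some k''" by (rule mul_left_assoc[OF abz v c''(3)])
  ultimately have 1: "shift M y k' (d' # d # t) k'' (d'' # t)"
    unfolding shift_def k using path by blast
  have "pcong M (tgt M c'') y (d'' # t) (x # dd # t)"
    by (rule shift_tail[OF sh c''(2) z(1) dd(2)])
  also have "pcong M (tgt M c'') y \<dots> (x # d' # d # t)"
    using pcong_Cons[of x y "dd # t" "d' # d # t"] pcong_sym[OF tail] x_El by simp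
  finally have "pcong M (tgt M c'') y (d'' # t) (x # d' # d # t)" .
  moreover have "mul M k'' x = Some k'" by (rule mul_left_assoc[OF c''(3) z(1) abz])
  ultimately have "shift M y k'' (d'' # t) k' (d' # d # t)"
    unfolding shift_def k using path by blast
  with 1 show ?thesis ..
qed

lemma hdec_shift_append:
  assumes "\<And>h t h' t'. hdec M y v h t \<Longrightarrow> hdec M y v' h' t' \<Longrightarrow> shift M y h t h' t'"
  shows "hdec M y (u @ v) h t \<Longrightarrow> hdec M y (u @ v') h' t' \<Longrightarrow> shift M y h t h' t'"
proof (induction u arbitrary: h t h' t')
  case Nil
  with assms show ?case by simp
next
  case (Cons a u)
  from Cons.prems show ?case
    by (auto elim!: hdec_ConsE intro: shift_step[OF Cons.IH])
qed

lemma hdec_unique: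
  assumes "hdec M y w h t" "hdec M y w h' t'"
  shows "shift M y h t h' t'"
proof -
  have "shift M y h t h' t'" if "hdec M y [] h t" "hdec M y [] h' t'" for h t h' t'
    using that by (auto elim!: hdec_NilE intro!: shift_refl simp: ident_El tgt_ident)
  from hdec_shift_append[of y "[]" "[]" w, OF this] assms show ?thesis by simp
qed

text \<open>
  Heads and tails are invariants of congruence classes: a relation applied at the front of a path
  changes nothing by \<open>shift_mul\<close> and \<open>shift_ident\<close>, and \<open>shift_step\<close> transports this to relations
  applied behind a prefix.
\<close>

theorem hdec_cong:
  "pcong M x y w w' \<Longrightarrow> hdec M y w h t \<Longrightarrow> hdec M y w' h' t'
     \<Longrightarrow> shift M y h t h' t' \<and> shift M y h' t' h t"
proof (induction arbitrary: h t h' t' rule: pcong.induct)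
  case (pcong_mul u a b v c)
  have *: "shift M y h1 t1 h2 t2 \<and> shift M y h2 t2 h1 t1"
    if "hdec M y ([a, b] @ v) h1 t1" "hdec M y ([c] @ v) h2 t2" for h1 t1 h2 t2
  proof -
    from that(1) obtain h t c0 d k c' d' where
      1: "hdec M y v h t" "is_greatest M (JS M b h) c0" "mul M c0 d = Some h" "mul M b c0 = Some k"
        "is_greatest M (JS M a k) c'" "mul M c' d' = Some k" "mul M a c' = Some h1" "t1 = d' # d # t"
      by (auto elim!: hdec_ConsE)
    from that(2) obtain h' t' c'' d'' where
      2: "hdec M y v h' t'" "is_greatest M (JS M c h') c''" "mul M c'' d'' = Some h'"
        "mul M c c'' = Some h2" "t2 = d'' # t'"
      by (auto elim!: hdec_ConsE)
    have h: "h \<in> El M" "is_path M (tgt M h) t y" using hdec_path[OF 1(1)] by auto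
    have "tgt M c = src M h"
      using mul_cod[OF pcong_mul.hyps(2)] mul_dom[OF 1(4)] mul_cod[OF 1(3)] by simp
    then obtain c3 d3 k3 where 3: "is_greatest M (JS M c h) c3" "mul M c3 d3 = Some h"
        "mul M c c3 = Some k3"
      using hdec_step_ex[of c h] h mul_cod[OF pcong_mul.hyps(2)] by blast
    note s1 = shift_mul[OF h(2) pcong_mul.hyps(2) 1(2-7) 3]
    have s2: "shift M y k3 (d3 # t) h2 t2" "shift M y h2 t2 k3 (d3 # t)"
      unfolding 2(5)
      by (rule shift_step[OF hdec_unique[OF 1(1) 2(1)] 3 2(2-4)],
          rule shift_step[OF hdec_unique[OF 2(1) 1(1)] 2(2-4) 3])
    show ?thesis unfolding 1(8) using s1 s2 shift_trans by blast
  qed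
  have "shift M y h t h' t'"
    by (rule hdec_shift_append[OF _ pcong_mul.prems]) (use * in blast)
  moreover have "shift M y h' t' h t"
    by (rule hdec_shift_append[OF _ pcong_mul.prems(2,1)]) (use * in blast)
  ultimately show ?case ..
next
  case (pcong_ident u z v)
  then have v: "is_path M z v y" by (auto simp: is_path_append tgt_ident)
  have *: "shift M y h1 t1 h2 t2 \<and> shift M y h2 t2 h1 t1"
    if "hdec M y ([ident M z] @ v) h1 t1" "hdec M y v h2 t2" for h1 t1 h2 t2
  proof -
    from that(1) obtain h t c d where
      1: "hdec M y v h t" "is_greatest M (JS M (ident M z) h) c" "mul M c d = Some h"
        "mul M (ident M z) c = Some h1" "t1 = d # t"
      by (auto elim!: hdec_ConsE)
    have "src M h = z"
      using mul_cod[OF 1(3)] mul_dom[OF 1(4)] pcong_ident.hyps(2) by (simp add: tgt_ident)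
    then have "shift M y h1 t1 h t" "shift M y h t h1 t1"
      using shift_ident[of h t y c d h1] 1 hdec_path[OF 1(1)] by auto
    then show ?thesis
      using hdec_unique[OF 1(1) that(2)] hdec_unique[OF that(2) 1(1)] shift_trans by blast
  qed
  have "shift M y h t h' t'"
    by (rule hdec_shift_append[OF _ pcong_ident.prems]) (use * in blast)
  moreover have "shift M y h' t' h t"
    by (rule hdec_shift_append[OF _ pcong_ident.prems(2,1)]) (use * in blast)
  ultimately show ?case ..
next
  case (pcong_refl u)
  then show ?case using hdec_unique by blast
next
  case (pcong_sym u v)
  then show ?case by blast
next
  case (pcong_trans u v w)
  obtain h1 t1 where "hdec M y v h1 t1"
    using hdec_ex pcong_is_path[OF pcong_trans.hyps(1)] by blast
  then show ?case using pcong_trans shift_trans by blast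
qed

lemma hdec_greatest:
  assumes "hdec M y w h t" "pcong M x y w (s # v)"
  shows "ldiv M s h"
proof -
  obtain k t' where k: "hdec M y (s # v) k t'" using hdec_ex pcong_is_path[OF assms(2)] by blast
  then have "ldiv M s k" by (auto elim!: hdec_ConsE intro: ldivI)
  moreover have "ldiv M k h" using hdec_cong[OF assms(2,1) k] shift_ldiv by blast
  ultimately show ?thesis by (rule ldiv_trans)
qed

text \<open>
  The head of \<open>a w\<close> has the form \<open>a \<bullet> c\<close>. Comparing the heads \<open>a \<bullet> c\<close> and \<open>a \<bullet> c'\<close> of \<open>a w\<close> and
  \<open>a w'\<close>, the factor \<open>a\<close> can be cancelled inside the germ, and \<open>c\<close> followed by the tail of \<open>a w\<close>
  gives \<open>w\<close> back.
\<close>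

theorem pcong_cancel:
  assumes "pcong M x y (a # w) (a # w')"
  shows "pcong M (tgt M a) y w w'"
proof -
  have p: "a \<in> El M" "is_path M (tgt M a) w y" "is_path M (tgt M a) w' y"
    using pcong_is_path[OF assms] by auto
  then have aw: "is_path M (src M a) (a # w) y" "is_path M (src M a) (a # w') y" by auto
  obtain k1 t1 where k1: "hdec M y (a # w) k1 t1" using hdec_ex[OF aw(1)] by blast
  obtain k2 t2 where k2: "hdec M y (a # w') k2 t2" using hdec_ex[OF aw(2)] by blast
  have sh: "shift M y k1 t1 k2 t2" using hdec_cong[OF assms k1 k2] ..
  from k1 obtain h t c d where
    1: "hdec M y w h t" "mul M c d = Some h" "mul M a c = Some k1" "t1 = d # t"
    by (auto elim!: hdec_ConsE)
  from k2 obtain h' t' c' d' where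
    2: "hdec M y w' h' t'" "mul M c' d' = Some h'" "mul M a c' = Some k2" "t2 = d' # t'"
    by (auto elim!: hdec_ConsE)
  obtain e where e: "mul M k1 e = Some k2" "pcong M (tgt M k1) y (d # t) (e # d' # t')"
    using sh 1 2 by (auto simp: shift_def)
  obtain ce where ce: "mul M c e = Some ce" "mul M a ce = Some k2"
    using mul_right_assoc[OF 1(3) e(1)] .
  have ce': "mul M c e = Some c'" using ce cancel[OF ce(2) 2(3)] by simp
  note doms = mul_dom[OF 1(2)] mul_cod[OF 1(2)] mul_dom[OF 1(3)] mul_cod[OF 1(3)]
    mul_dom[OF 2(2)] mul_cod[OF 2(2)] mul_dom[OF ce'] mul_cod[OF ce']
  have "pcong M (tgt M a) y w (h # t)"
    using hdec_path[OF 1(1)] doms by auto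
  also have "pcong M (tgt M a) y \<dots> (c # d # t)"
    using pcong_sym[OF pcong_mul_Cons[OF 1(2), of t y]] hdec_path[OF 1(1)] doms by simp
  also have "pcong M (tgt M a) y \<dots> (c # e # d' # t')"
    using pcong_Cons[of c y "d # t" "e # d' # t'"] e(2) doms by simp
  also have "pcong M (tgt M a) y \<dots> (c' # d' # t')"
    using pcong_mul_Cons[OF ce', of "d' # t'" y] hdec_path[OF 2(1)] doms by simp
  also have "pcong M (tgt M a) y \<dots> (h' # t')"
    using pcong_mul_Cons[OF 2(2), of t' y] hdec_path[OF 2(1)] doms by simp
  also have "pcong M (tgt M a) y \<dots> w'"
    using hdec_path[OF 2(1)] doms by (auto intro: pcong_sym)
  finally show ?thesis .
qed

lemma pcong_append_cancel:
  "pcong M x z (u @ v) (u @ v') \<Longrightarrow> is_path M x u y \<Longrightarrow> pcong M y z v v'"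
  by (induction u arbitrary: x) (auto dest: pcong_cancel)


section \<open>Normal forms\<close>

text \<open>
  The tail has to become shorter for the splitting off of heads to come to an end. The one in
  \<open>hdec\<close> does not, as the empty path already has an identity as its head. But a path of one element
  can be taken as its own head, with an empty tail; from there on, the tail grows by one element at
  each step, like the path.
\<close>

lemma head_ex:
  "is_path M x w y \<Longrightarrow> w \<noteq> [] \<Longrightarrow>
     \<exists>h t. pcong M x y w (h # t) \<and> length t < length w
       \<and> (\<forall>s v. pcong M x y w (s # v) \<longrightarrow> ldiv M s h)"
proof (induction w arbitrary: x)
  case (Cons a w)
  have a: "a \<in> El M" "src M a = x" "is_path M (tgt M a) w y" using Cons.prems by auto
  show ?case
  proof (cases "w = []")
    case True
    then show ?thesis
      using Cons.prems pcong_single_ldiv[of x y a] by (auto intro!: exI[of _ a] exI[of _ "[]"] pcong_refl)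
  next
    case False
    then obtain h t where h: "pcong M (tgt M a) y w (h # t)" "length t < length w"
      "\<And>s v. pcong M (tgt M a) y w (s # v) \<Longrightarrow> ldiv M s h"
      using Cons.IH[OF a(3)] by blast
    obtain k t0 where k: "hdec M y (a # w) k t0" using hdec_ex[OF Cons.prems(1)] by blast
    then obtain H T c where H: "hdec M y w H T" "is_greatest M (JS M a H) c" "mul M a c = Some k"
      by (auto elim!: hdec_ConsE)
    have "src M H = tgt M a"
      using mul_dom[OF H(3)] H(2) mul_cod by (auto simp: is_greatest_def JS_iff ldiv_def)
    then have "ldiv M H h" using h(3)[of H T] hdec_path[OF H(1)] by simp
    then have "ldiv M c h"
      using H(2) ldiv_trans by (auto simp: is_greatest_def JS_iff)
    then obtain d where d: "mul M c d = Some h" by (auto simp: ldiv_def)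
    have t: "is_path M (tgt M h) t y" using pcong_is_path[OF h(1)] by simp
    note doms = mul_dom[OF d] mul_cod[OF d] mul_dom[OF H(3)] mul_cod[OF H(3)]
    have "pcong M x y (a # w) (a # h # t)" using pcong_Cons[OF h(1)] a by simp
    also have "pcong M x y \<dots> (a # c # d # t)"
      using pcong_Cons[of a y "h # t" "c # d # t"] pcong_sym[OF pcong_mul_Cons[OF d, of t y]] doms a t
      by simp
    also have "pcong M x y \<dots> (k # d # t)"
      using pcong_mul_Cons[OF H(3), of "d # t" y] doms a t by simp
    finally show ?thesis
      using h(2) hdec_greatest[OF k] by (intro exI[of _ k] exI[of _ "d # t"]) auto
  qed
qed simp

text \<open>
  Each entry is compared with the whole product from there on, and not only with its product with
  the next one: this is what the splitting off of heads yields, and it implies the condition on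
  pairs.
\<close>

fun heads where
  "heads y [] \<longleftrightarrow> True"
| "heads y (h # t) \<longleftrightarrow> (\<forall>s v. pcong M (src M h) y (h # t) (s # v) \<longrightarrow> ldiv M s h) \<and> heads y t"

lemma heads_ex:
  "is_path M x w y \<Longrightarrow> \<exists>hs. pcong M x y w hs \<and> heads y hs \<and> (w \<noteq> [] \<longrightarrow> hs \<noteq> [])"
proof (induction "length w" arbitrary: w x rule: less_induct)
  case less
  show ?case
  proof (cases "w = []")
    case True
    then show ?thesis using less.prems by (intro exI[of _ "[]"]) (auto intro: pcong_refl)
  next
    case False
    then obtain h t where h: "pcong M x y w (h # t)" "length t < length w"
      "\<And>s v. pcong M x y w (s # v) \<Longrightarrow> ldiv M s h"
      using head_ex[OF less.prems] by blast
    then have p: "h \<in> El M" "src M h = x" "is_path M (tgt M h) t y"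
      using pcong_is_path[OF h(1)] by auto
    obtain hs where hs: "pcong M (tgt M h) y t hs" "heads y hs"
      using less.hyps[OF h(2) p(3)] by blast
    have w: "pcong M x y w (h # hs)"
      using pcong_trans[OF h(1)] pcong_Cons[OF hs(1) p(1)] p(2) by blast
    have "ldiv M s h" if "pcong M x y (h # hs) (s # v)" for s v
      using h(3) pcong_trans[OF w that] by blast
    with w hs(2) p(2) show ?thesis by (intro exI[of _ "h # hs"]) auto
  qed
qed

text \<open>
  By induction on \<open>f\<close>, the head of \<open>f h k\<close> divides \<open>f h\<close>: if the head \<open>H\<close> of \<open>f h k\<close> does, then so
  does the head of \<open>a f h k\<close>, being \<open>a\<close> times a left divisor of \<open>H\<close>.
\<close>

lemma heads_normal:
  assumes hk: "\<And>s v. pcong M (src M h) (tgt M k) [h, k] (s # v) \<Longrightarrow> ldiv M s h"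
  shows "pcong M x (tgt M k) (f @ [h, k]) (s # v) \<Longrightarrow> \<exists>v'. pcong M x (tgt M h) (f @ [h]) (s # v')"
proof (induction f arbitrary: x s v)
  case Nil
  then have p: "h \<in> El M" "x = src M h" using pcong_is_path[OF Nil] by auto
  then obtain b where b: "mul M s b = Some h" using hk Nil by (auto simp: ldiv_def)
  then have "pcong M x (tgt M h) [s, b] [h]"
    using pcong_mul_Cons[OF b, of "[]"] mul_cod[OF b] mul_dom[OF b] p
    by (simp add: tgt_Ob)
  from pcong_sym[OF this] show ?case by (intro exI[of _ "[b]"]) simp
next
  case (Cons a f)
  let ?z = "tgt M k"
  have p: "a \<in> El M" "x = src M a" "is_path M (tgt M a) (f @ [h, k]) ?z"
    using pcong_is_path[OF Cons.prems] by auto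
  then have "is_path M x (a # f @ [h, k]) ?z" by simp
  then obtain g t where g: "hdec M ?z (a # f @ [h, k]) g t"
    using hdec_ex by blast
  then obtain H T c d where H: "hdec M ?z (f @ [h, k]) H T" "mul M c d = Some H" "mul M a c = Some g"
    by (auto elim!: hdec_ConsE)
  note doms = mul_dom[OF H(2)] mul_cod[OF H(2)] mul_dom[OF H(3)] mul_cod[OF H(3)]
  have "pcong M (tgt M a) ?z (f @ [h, k]) (H # T)" using hdec_path[OF H(1)] doms by simp
  then obtain v' where v': "pcong M (tgt M a) (tgt M h) (f @ [h]) (H # v')"
    using Cons.IH by blast
  have "ldiv M s g" using hdec_greatest[OF g] Cons.prems by simp
  then obtain b where b: "mul M s b = Some g" by (auto simp: ldiv_def)
  have v'_path: "is_path M (tgt M H) v' (tgt M h)" using pcong_is_path[OF v'] by simp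
  have "pcong M x (tgt M h) ((a # f) @ [h]) (a # H # v')"
    using pcong_Cons[OF v' p(1)] p(2) by simp
  also have "pcong M x (tgt M h) \<dots> (a # c # d # v')"
    using pcong_Cons[of a "tgt M h" "H # v'" "c # d # v'"]
      pcong_sym[OF pcong_mul_Cons[OF H(2), of v' "tgt M h"]] v'_path doms p by simp
  also have "pcong M x (tgt M h) \<dots> (g # d # v')"
    using pcong_mul_Cons[OF H(3), of "d # v'" "tgt M h"] v'_path doms p by simp
  also have "pcong M x (tgt M h) \<dots> (s # b # d # v')"
    using pcong_sym[OF pcong_mul_Cons[OF b, of "d # v'" "tgt M h"]] v'_path doms p mul_cod[OF b]
      mul_dom[OF b] by simp
  finally show ?case by blast
qed

end

section \<open>Recognition of Garside germs\<close>

lemma (in category) left_associative: "left_associative M"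
  unfolding left_associative_def
proof (intro allI impI, elim conjE)
  fix a b c ab abc assume "mul M a b = Some ab" "mul M ab c = Some abc"
  from mul_dom[OF this(1)] mul_cod[OF this(1)] mul_dom[OF this(2)]
  show "\<exists>bc. mul M b c = Some bc" by (intro mul_total) auto
qed

lemma (in category) mul_assoc_total:
  assumes "mul M f g = Some fg" "mul M fg h = Some k"
  obtains gh where "mul M g h = Some gh" "mul M f gh = Some k"
proof -
  obtain gh where gh: "mul M g h = Some gh"
    using left_associative assms unfolding left_associative_def by blast
  with mul_assoc[OF assms(1) gh] assms(2) that show ?thesis by simp
qed

lemma (in category) ldiv_trans: "ldiv M a b \<Longrightarrow> ldiv M b c \<Longrightarrow> ldiv M a c"
  using left_associative_imp_transp_ldiv[OF germ_axioms left_associative] by (blast dest: transpD)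

text \<open>
  The elements \<open>f\<close> in the definition of normal paths make an induction possible: the entries after
  the first one are removed from the end, the entries before serving as \<open>f\<close>.
\<close>

lemma (in category) ldiv_first_of_normal_path:
  assumes "normal_path M S (g # gs)" "path_prod M (g # gs) = Some p" "a \<in> S"
    and "mul M f p = Some fp" "ldiv M a fp"
  shows "\<exists>k. mul M f g = Some k \<and> ldiv M a k"
  using assms
proof (induction gs arbitrary: g p f)
  case Nil
  then show ?case by simp
next
  case (Cons h gs)
  from Cons.prems(2) obtain q where q: "path_prod M (h # gs) = Some q" "mul M g q = Some p"
    by (auto split: option.splits)
  have consec: "\<And>i. Suc i < length (g # h # gs)
        \<Longrightarrow> tgt M ((g # h # gs) ! i) = src M ((g # h # gs) ! Suc i)"
    and greedy: "\<And>i a f fg fgh. Suc i < length (g # h # gs) \<Longrightarrow> a \<in> S \<Longrightarrow> f \<in> El M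
        \<Longrightarrow> mul M f ((g # h # gs) ! i) = Some fg \<Longrightarrow> mul M fg ((g # h # gs) ! Suc i) = Some fgh
        \<Longrightarrow> ldiv M a fgh \<Longrightarrow> ldiv M a fg"
    and sharp: "set (g # h # gs) \<subseteq> sharp M S"
    using Cons.prems(1) unfolding normal_path_def by blast+
  have normal: "normal_path M S (h # gs)"
    unfolding normal_path_def
  proof (intro conjI allI impI ballI)
    fix i assume i: "Suc i < length (h # gs)"
    show "tgt M ((h # gs) ! i) = src M ((h # gs) ! Suc i)"
      using consec[of "Suc i"] i by simp
    fix a f fg fgh
    assume "a \<in> S" "f \<in> El M" "mul M f ((h # gs) ! i) = Some fg \<and>
        mul M fg ((h # gs) ! Suc i) = Some fgh \<and> ldiv M a fgh"
    then show "ldiv M a fg" using greedy[of "Suc i" a f fg fgh] i by simp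
  qed (use sharp in auto)
  have "tgt M f = src M g" "f \<in> El M" "g \<in> El M"
    using mul_dom[OF Cons.prems(4)] mul_dom[OF q(2)] mul_cod[OF q(2)] by auto
  then obtain fg where fg: "mul M f g = Some fg" using mul_total by blast
  have "mul M fg q = Some fp" using mul_assoc[OF fg q(2)] Cons.prems(4) by simp
  from Cons.IH[OF normal q(1) Cons.prems(3) this Cons.prems(5)]
  obtain k where "mul M fg h = Some k" "ldiv M a k" by blast
  then have "ldiv M a fg"
    using greedy[of 0 a f fg k] Cons.prems(3) fg \<open>f \<in> El M\<close> by simp
  with fg show ?case by blast
qed

text \<open>Entries of normal paths may be replaced by elements of \<open>S\<close> as far as divisibility goes.\<close>

lemma (in category) sharp_cases:
  assumes "g \<in> sharp M S" "\<And>x. x \<in> Ob M \<Longrightarrow> ident M x \<in> S"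
  obtains s where "s \<in> S" "ldiv M s g" "ldiv M g s"
proof -
  have inv: "ldiv M k s" if se: "mul M s e = Some k" "e \<in> invertibles M" for s e k
  proof -
    obtain e' where e': "mul M e e' = Some (ident M (src M e))"
      using se(2) by (auto simp: invertibles_def)
    have "mul M k e' = mul M s (ident M (src M e))" by (rule mul_assoc[OF se(1) e'])
    also have "\<dots> = Some s" using mul_dom[OF se(1)] mul_ident[of s] by simp
    finally show ?thesis by (rule ldivI)
  qed
  from assms(1) consider (S) s e where "s \<in> S" "e \<in> invertibles M" "mul M s e = Some g"
    | (inv) "g \<in> invertibles M" by (auto simp: sharp_def)
  then show ?thesis
  proof cases
    case S
    from that[OF S(1) ldivI[OF S(3)] inv[OF S(3,2)]] show ?thesis .
  next
    case inv': inv
    then have g: "g \<in> El M" by (simp add: invertibles_def)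
    then have e: "mul M (ident M (src M g)) g = Some g" by (rule ident_mul)
    from that[OF assms(2)[OF src_Ob[OF g]] ldivI[OF e] inv[OF e inv']] show ?thesis .
  qed
qed

context germ
begin

lemma gen_cls: "gen M a = cls (src M a) [a] (tgt M a)"
  by (simp add: gen_def)

lemma cls_eq_iff:
  assumes "is_path M x u y"
  shows "cls x u y = cls x' v y' \<longleftrightarrow> x' = x \<and> y' = y \<and> pcong M x y u v"
proof
  assume *: "cls x u y = cls x' v y'"
  moreover have "(x, u, y) \<in> cls x u y" using assms by (simp add: path_rel_iff pcong_refl)
  ultimately show "x' = x \<and> y' = y \<and> pcong M x y u v"
    using pcong_sym by (auto simp: path_rel_iff)
next
  assume "x' = x \<and> y' = y \<and> pcong M x y u v"
  then show "cls x u y = cls x' v y'" using cls_eqI by blast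
qed

lemma src_gen: "a \<in> El M \<Longrightarrow> src (Cat M) (gen M a) = src M a"
  and tgt_gen: "a \<in> El M \<Longrightarrow> tgt (Cat M) (gen M a) = tgt M a"
  unfolding gen_cls by (simp_all add: Cat_src Cat_tgt tgt_Ob)

lemma gen_El: "a \<in> El M \<Longrightarrow> gen M a \<in> El (Cat M)"
  unfolding gen_cls Cat_El_iff using is_path_single by blast

lemma Cat_ident: "ident (Cat M) x = cls x [] x"
  by (simp add: Cat_def Let_def)

lemma Cat_Ob: "Ob (Cat M) = Ob M"
  by (simp add: Cat_def Let_def)

lemma gen_ident: "x \<in> Ob M \<Longrightarrow> gen M (ident M x) = ident (Cat M) x"
  unfolding gen_cls Cat_ident
  using pcong_ident_Cons[of x "[]" x] by (simp add: src_ident tgt_ident cls_eqI)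

lemma gen_mul:
  assumes "mul M a b = Some c"
  shows "mul (Cat M) (gen M a) (gen M b) = Some (gen M c)"
proof -
  note ab = mul_dom[OF assms]
  have "cls (src M a) [a, b] (tgt M b) = cls (src M a) [c] (tgt M b)"
    using pcong_mul_Cons[OF assms, of "[]" "tgt M b"] ab by (intro cls_eqI) (simp add: tgt_Ob)
  moreover have "is_path M (tgt M a) [b] (tgt M b)" using ab by (simp add: tgt_Ob)
  ultimately show ?thesis
    using Cat_mul[OF is_path_single, of a "[b]" "tgt M b"] ab mul_cod[OF assms]
    by (simp add: gen_cls)
qed

lemma ldiv_gen:
  assumes "s \<in> El M" "is_path M x w y"
  shows "ldiv (Cat M) (gen M s) (cls x w y) \<longleftrightarrow> (\<exists>v. pcong M x y w (s # v))"
proof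
  assume "ldiv (Cat M) (gen M s) (cls x w y)"
  then obtain X where X: "mul (Cat M) (gen M s) X = Some (cls x w y)" by (auto simp: ldiv_def)
  from Cat_mul_cases[OF this] obtain x' u z v y' where *: "is_path M x' u z" "is_path M z v y'"
    "gen M s = cls x' u z" "cls x w y = cls x' (u @ v) y'" by metis
  then have "x' = src M s" "z = tgt M s" "pcong M (src M s) (tgt M s) [s] u"
    using cls_eq_iff[OF is_path_single[OF assms(1)]] by (auto simp: gen_cls)
  moreover have "x' = x" "y' = y" "pcong M x y w (u @ v)"
    using cls_eq_iff[OF assms(2)] *(4) by auto
  ultimately have "pcong M x y w (s # v)"
    using pcong_append[OF _ pcong_refl[OF *(2)], of x u "[s]"] pcong_sym pcong_trans by fastforce
  then show "\<exists>v. pcong M x y w (s # v)" ..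
next
  assume "\<exists>v. pcong M x y w (s # v)"
  then obtain v where v: "pcong M x y w (s # v)" ..
  then have p: "x = src M s" "is_path M (tgt M s) v y" using pcong_is_path[OF v] by auto
  have "mul (Cat M) (gen M s) (cls (tgt M s) v y) = Some (cls x w y)"
    using Cat_mul[OF is_path_single[OF assms(1)] p(2)] cls_eqI[OF v] p(1) by (simp add: gen_cls)
  then show "ldiv (Cat M) (gen M s) (cls x w y)"
    by (rule germ.ldivI[OF category.axioms(1)[OF category_Cat]])
qed

end

context left_assoc_germ
begin

lemma inj_gen: "inj_on (gen M) (El M)"
proof (rule inj_onI)
  fix a b assume a: "a \<in> El M" and b: "b \<in> El M" and eq: "gen M a = gen M b"
  have *: "src M b = src M a \<and> tgt M b = tgt M a \<and> pcong M (src M a) (tgt M a) [a] [b]"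
    by (rule iffD1[OF cls_eq_iff[OF is_path_single[OF a]] eq[unfolded gen_cls]])
  then have "path_val M (tgt M a) [a] = path_val M (tgt M a) [b]"
    by (intro path_val_cong) blast
  then have "Some a = Some b"
    unfolding path_val_single[OF a] using path_val_single[OF b] * by metis
  then show "a = b" by simp
qed

lemma ldiv_gen_gen:
  assumes "s \<in> El M" "a \<in> El M"
  shows "ldiv (Cat M) (gen M s) (gen M a) \<longleftrightarrow> ldiv M s a"
proof
  assume "ldiv (Cat M) (gen M s) (gen M a)"
  then obtain v where "pcong M (src M a) (tgt M a) [a] (s # v)"
    unfolding gen_cls[of a] ldiv_gen[OF assms(1) is_path_single[OF assms(2)]] ..
  then show "ldiv M s a" by (rule pcong_single_ldiv)
next
  assume "ldiv M s a"
  then obtain b where "mul M s b = Some a" by (auto simp: ldiv_def)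
  then show "ldiv (Cat M) (gen M s) (gen M a)"
    by (rule germ.ldivI[OF category.axioms(1)[OF category_Cat] gen_mul])
qed

text \<open>
  In a Garside germ, the first entry of a normal decomposition of \<open>a\<^sub>1 a\<^sub>2\<close> is, up to an invertible
  factor, the greatest element of the germ dividing \<open>a\<^sub>1 a\<^sub>2\<close>. Being divisible by \<open>a\<^sub>1\<close>, it is of the
  form \<open>a\<^sub>1 \<bullet> c\<close>, and \<open>c\<close> is the greatest element wanted.
\<close>

lemma garside_germ_imp_greatest_J:
  assumes "garside_germ M"
  shows "greatest_J M"
  unfolding greatest_J_def
proof (intro ballI impI)
  fix a1 a2 assume a: "a1 \<in> El M" "a2 \<in> El M" "tgt M a1 = src M a2"
  interpret C: category "Cat M" by (rule category_Cat)
  let ?S = "gen M ` El M"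
  have lc: "left_cancellative (Cat M)" and gf: "garside_family (Cat M) ?S"
    using assms by (auto simp: garside_germ_def)
  have path: "is_path M (src M a1) [a1, a2] (tgt M a2)" using a by (simp add: tgt_Ob)
  define G where "G = cls (src M a1) [a1, a2] (tgt M a2)"
  have G: "G \<in> El (Cat M)" unfolding G_def Cat_El_iff using path by blast
  have G_mul: "mul (Cat M) (gen M a1) (gen M a2) = Some G"
    using Cat_mul[OF is_path_single[OF a(1)], of "[a2]" "tgt M a2"] a by (simp add: gen_cls G_def tgt_Ob)
  obtain gs where gs: "normal_path (Cat M) ?S gs" "path_prod (Cat M) gs = Some G"
    using gf G by (auto simp: garside_family_def)
  then obtain g gs' where gs_Cons: "gs = g # gs'" by (cases gs) (auto simp: normal_path_def)
  have "g \<in> sharp (Cat M) ?S" using gs(1) by (auto simp: normal_path_def gs_Cons)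
  moreover have "ident (Cat M) x \<in> ?S" if "x \<in> Ob (Cat M)" for x
    using that ident_El[of x] by (simp add: Cat_Ob flip: gen_ident)
  ultimately obtain s where "s \<in> ?S" "ldiv (Cat M) s g" "ldiv (Cat M) g s"
    by (rule C.sharp_cases)
  then obtain h where h: "h \<in> El M" "ldiv (Cat M) (gen M h) g" "ldiv (Cat M) g (gen M h)"
    by auto
  have gG: "ldiv (Cat M) g G"
    using gs(2) C.ldivI C.ldiv_refl[OF G] by (cases gs') (auto simp: gs_Cons split: option.splits)
  have hG: "ldiv (Cat M) (gen M h) G" using C.ldiv_trans[OF h(2) gG] .
  have greatest: "ldiv M s h" if "s \<in> El M" "ldiv (Cat M) (gen M s) G" for s
  proof -
    have "\<exists>k. mul (Cat M) (ident (Cat M) (src (Cat M) G)) g = Some k \<and> ldiv (Cat M) (gen M s) k"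
      using gs(1)[unfolded gs_Cons] gs(2)[unfolded gs_Cons] _ C.ident_mul[OF G] that(2)
      by (rule C.ldiv_first_of_normal_path) (use that(1) in simp)
    moreover have "src (Cat M) g = src (Cat M) G" "g \<in> El (Cat M)"
      using gG C.mul_dom[of g] C.mul_cod[of g] unfolding ldiv_def by fastforce+
    ultimately have "ldiv (Cat M) (gen M s) g" using C.ident_mul[of g] by simp
    from C.ldiv_trans[OF this h(3)] show ?thesis
      by (simp add: ldiv_gen_gen[OF that(1) h(1)])
  qed
  have "ldiv M a1 h" by (rule greatest[OF a(1) C.ldivI[OF G_mul]])
  then obtain c where c: "mul M a1 c = Some h" by (auto simp: ldiv_def)
  have c_El: "c \<in> El M" using mul_dom[OF c] by simp
  have "ldiv M c a2"
  proof -
    obtain X where X: "mul (Cat M) (gen M h) X = Some G" using hG by (auto simp: ldiv_def)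
    obtain Y where Y: "mul (Cat M) (gen M c) X = Some Y" "mul (Cat M) (gen M a1) Y = Some G"
      using C.mul_assoc_total[OF gen_mul[OF c] X] .
    have "Y = gen M a2" using lc Y(2) G_mul unfolding left_cancellative_def by blast
    then show ?thesis using C.ldivI[OF Y(1)] ldiv_gen_gen[OF c_El a(2)] by simp
  qed
  then have "c \<in> JS M a1 a2" using c c_El by (auto simp: JS_def)
  moreover have "ldiv M b c" if "b \<in> JS M a1 a2" for b
  proof -
    from that obtain k b' where b: "mul M a1 b = Some k" "mul M b b' = Some a2" "b \<in> El M"
      by (auto simp: JS_def ldiv_def)
    have "mul (Cat M) (gen M k) (gen M b') = Some G"
      using C.mul_assoc[OF gen_mul[OF b(1)] gen_mul[OF b(2)]] G_mul by simp
    moreover have "k \<in> El M" using mul_cod[OF b(1)] by simp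
    ultimately have "ldiv M k h" using greatest C.ldivI by blast
    then obtain x where x: "mul M k x = Some h" by (auto simp: ldiv_def)
    obtain bx where bx: "mul M b x = Some bx" "mul M a1 bx = Some h"
      using mul_right_assoc[OF b(1) x] .
    have "gen M bx = gen M c"
      using lc gen_mul[OF bx(2)] gen_mul[OF c] unfolding left_cancellative_def by blast
    then have "bx = c" using inj_gen c_El mul_cod[OF bx(1)] by (auto dest: inj_onD)
    then show ?thesis using ldivI[OF bx(1)] by simp
  qed
  ultimately show "\<exists>c. is_greatest M (JS M a1 a2) c" by (auto simp: is_greatest_def)
qed

lemma garside_germ_imp_left_cancellative:
  assumes "garside_germ M"
  shows "left_cancellative M"
  unfolding left_cancellative_def
proof (intro allI impI, elim conjE)
  fix a b b' c assume *: "mul M a b = Some c" "mul M a b' = Some c"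
  have "left_cancellative (Cat M)" using assms by (simp add: garside_germ_def)
  then have "gen M b = gen M b'"
    using gen_mul[OF *(1)] gen_mul[OF *(2)] unfolding left_cancellative_def by blast
  then show "b = b'" using inj_gen mul_dom[OF *(1)] mul_dom[OF *(2)] by (auto dest: inj_onD)
qed

end

context J_germ
begin

lemma left_cancellative_Cat: "left_cancellative (Cat M)"
  unfolding left_cancellative_def
proof (intro allI impI, elim conjE)
  fix X Y Y' Z assume 1: "mul (Cat M) X Y = Some Z" and 2: "mul (Cat M) X Y' = Some Z"
  from Cat_mul_cases[OF 1] obtain x u y v z where
    a: "is_path M x u y" "is_path M y v z" "X = cls x u y" "Y = cls y v z" "Z = cls x (u @ v) z" .
  from Cat_mul_cases[OF 2] obtain x' u' y' v' z' where
    b: "is_path M x' u' y'" "is_path M y' v' z'" "X = cls x' u' y'" "Y' = cls y' v' z'"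
      "Z = cls x' (u' @ v') z'" .
  have xy: "x' = x" "y' = y" using cls_eq_iff[OF a(1), of x' u' y'] a(3) b(3) by auto
  have uv: "is_path M x (u @ v) z" using a by (auto simp: is_path_append)
  have "Z = cls x (u @ v') z'"
    using Cat_mul[OF a(1), of v' z'] 2 a(3) b xy by simp
  then have "z' = z" "pcong M x z (u @ v) (u @ v')"
    using cls_eq_iff[OF uv, of x "u @ v'" z'] a(5) by auto
  with pcong_append_cancel[OF this(2) a(1)] show "Y = Y'"
    using a(4) b(4) xy cls_eqI by simp
qed

lemma path_prod_gen:
  "hs \<noteq> [] \<Longrightarrow> is_path M x hs y \<Longrightarrow> path_prod (Cat M) (map (gen M) hs) = Some (cls x hs y)"
proof (induction hs arbitrary: x)
  case (Cons a hs)
  show ?case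
  proof (cases hs)
    case Nil
    with Cons.prems show ?thesis by (auto simp: gen_cls)
  next
    case (Cons b hs')
    with Cons.IH[of "tgt M a"] Cons.prems Cat_mul[OF is_path_single[of a], of hs y]
    show ?thesis by (auto simp: gen_cls)
  qed
qed simp

lemma heads_append: "heads y (u @ v) \<Longrightarrow> heads y v"
  by (induction u) auto

lemma normal_path_gen:
  assumes hs: "hs \<noteq> []" "is_path M x hs y" "heads y hs"
  shows "normal_path (Cat M) (gen M ` El M) (map (gen M) hs)"
proof -
  interpret C: category "Cat M" by (rule category_Cat)
  have El: "set hs \<subseteq> El M"
    using hs(2) by (induction hs arbitrary: x) auto
  have "gen M a \<in> sharp (Cat M) (gen M ` El M)" if a: "a \<in> El M" for a
  proof -
    let ?e = "ident (Cat M) (tgt (Cat M) (gen M a))"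
    have "tgt (Cat M) (gen M a) \<in> Ob (Cat M)" using C.tgt_Ob[OF gen_El[OF a]] .
    then have "?e \<in> invertibles (Cat M)"
      using C.ident_El C.src_ident C.tgt_ident C.ident_mul by (fastforce simp: invertibles_def)
    moreover have "mul (Cat M) (gen M a) ?e = Some (gen M a)" by (rule C.mul_ident[OF gen_El[OF a]])
    ultimately show ?thesis using a by (auto simp: sharp_def)
  qed
  then have 1: "set (map (gen M) hs) \<subseteq> sharp (Cat M) (gen M ` El M)" using El by auto
  have split: "\<exists>u h k v. hs ! i = h \<and> hs ! Suc i = k \<and> hs = u @ h # k # v" if "Suc i < length hs" for i
    using that by (metis Cons_nth_drop_Suc Suc_lessD append_take_drop_id)
  have consec: "h \<in> El M \<and> k \<in> El M \<and> tgt M h = src M k \<and>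
      (\<forall>s v. pcong M (src M h) (tgt M k) [h, k] (s # v) \<longrightarrow> ldiv M s h)"
    if i: "Suc i < length hs" "h = hs ! i" "k = hs ! Suc i" for i h k
  proof -
    obtain u v where hs_eq: "hs = u @ h # k # v" using split[OF i(1)] i by blast
    then have p: "h \<in> El M" "k \<in> El M" "tgt M h = src M k" "is_path M (tgt M k) v y"
      using hs(2) by (auto simp: is_path_append)
    have "ldiv M s h" if "pcong M (src M h) (tgt M k) [h, k] (s # w)" for s w
      using pcong_append[OF that pcong_refl[OF p(4)]] heads_append[of y u "h # k # v"] hs(3) hs_eq by auto
    with p show ?thesis by blast
  qed
  have 2: "ldiv (Cat M) a fg"
    if i: "Suc i < length hs" and a: "a \<in> gen M ` El M" and "f \<in> El (Cat M)"
      and fg: "mul (Cat M) f (gen M (hs ! i)) = Some fg"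
      and fgh: "mul (Cat M) fg (gen M (hs ! Suc i)) = Some fgh" and dv: "ldiv (Cat M) a fgh"
    for i a f fg fgh
  proof -
    define h where "h = hs ! i"
    define k where "k = hs ! Suc i"
    note hk = consec[OF i h_def k_def]
    obtain s where s: "s \<in> El M" "a = gen M s" using a by blast
    obtain x' w z where w: "is_path M x' w z" "f = cls x' w z"
      using \<open>f \<in> El (Cat M)\<close> unfolding Cat_El_iff by blast
    have "z = src M h"
      using C.mul_dom[OF fg] Cat_tgt[OF w(1)] src_gen[of h] hk w(2) by (simp add: h_def)
    then have wh: "is_path M x' (w @ [h]) (tgt M h)" "is_path M x' (w @ [h, k]) (tgt M k)"
      using w(1) hk tgt_Ob[of h] tgt_Ob[of k] by (auto simp: is_path_append)
    have "mul (Cat M) f (gen M h) = Some (cls x' (w @ [h]) (tgt M h))"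
      using Cat_mul[OF w(1)] is_path_single[of h] hk w(2) \<open>z = src M h\<close> unfolding gen_cls by blast
    then have fg': "fg = cls x' (w @ [h]) (tgt M h)" using fg by (simp flip: h_def)
    have "mul (Cat M) fg (gen M k) = Some (cls x' ((w @ [h]) @ [k]) (tgt M k))"
      unfolding fg' gen_cls using Cat_mul[OF wh(1)] is_path_single[of k] hk by metis
    then have fgh': "fgh = cls x' (w @ [h, k]) (tgt M k)" using fgh by (simp flip: k_def)
    obtain v where "pcong M x' (tgt M k) (w @ [h, k]) (s # v)"
      using dv ldiv_gen[OF s(1) wh(2)] by (auto simp: s(2) fgh')
    then have "\<exists>v'. pcong M x' (tgt M h) (w @ [h]) (s # v')"
      using hk by (intro heads_normal) auto
    then show ?thesis using ldiv_gen[OF s(1) wh(1)] by (simp add: s(2) fg')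
  qed
  have 3: "tgt (Cat M) (gen M (hs ! i)) = src (Cat M) (gen M (hs ! Suc i))" if "Suc i < length hs" for i
    using consec[OF that refl refl] by (simp add: src_gen tgt_gen)
  show ?thesis
    unfolding normal_path_def
  proof (intro conjI allI impI ballI)
    fix i assume "Suc i < length (map (gen M) hs)"
    then show "tgt (Cat M) (map (gen M) hs ! i) = src (Cat M) (map (gen M) hs ! Suc i)"
      using 3 by simp
  next
    fix i a f fg fgh
    assume "Suc i < length (map (gen M) hs)" "a \<in> gen M ` El M" "f \<in> El (Cat M)"
      "mul (Cat M) f (map (gen M) hs ! i) = Some fg \<and>
       mul (Cat M) fg (map (gen M) hs ! Suc i) = Some fgh \<and> ldiv (Cat M) a fgh"
    then show "ldiv (Cat M) a fg" using 2[of i a f fg fgh] by simp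
  qed (use hs(1) 1 in auto)
qed

lemma garside_germ: "garside_germ M"
proof -
  interpret C: category "Cat M" by (rule category_Cat)
  have "\<exists>gs. normal_path (Cat M) (gen M ` El M) gs \<and> path_prod (Cat M) gs = Some g"
    if "g \<in> El (Cat M)" for g
  proof -
    obtain x w y where w: "is_path M x w y" "g = cls x w y" using \<open>g \<in> El (Cat M)\<close> Cat_El_iff by blast
    \<comment> \<open>An identity is the class of a path of length one as well.\<close>
    obtain w' where w': "is_path M x w' y" "g = cls x w' y" "w' \<noteq> []"
    proof (cases "w = []")
      case True
      then have xy: "x = y" "x \<in> Ob M" using w(1) by auto
      have "pcong M x x [ident M x] []" using pcong_ident_Cons[of x "[]" x] xy by simp
      then show ?thesis using that[of "[ident M x]"] pcong_is_path cls_eqI w(2) True xy by blast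
    qed (use w that in blast)
    obtain hs where hs: "pcong M x y w' hs" "heads y hs" "hs \<noteq> []"
      using heads_ex[OF w'(1)] w'(3) by blast
    have p: "is_path M x hs y" using pcong_is_path[OF hs(1)] by simp
    show ?thesis
      using normal_path_gen[OF hs(3) p hs(2)] path_prod_gen[OF hs(3) p] cls_eqI[OF hs(1)] w'(2)
      by auto
  qed
  then have "garside_family (Cat M) (gen M ` El M)"
    using gen_El by (auto simp: garside_family_def)
  then show ?thesis using inj_gen left_cancellative_Cat by (simp add: garside_germ_def)
qed

end

theorem left_associative_garside_germ_iff:
  assumes "germ M"
  shows "left_associative M \<and> garside_germ M \<longleftrightarrow>
    left_associative M \<and> left_cancellative M \<and> greatest_J M"
proof (intro conj_cong refl)
  assume la: "left_associative M"
  interpret left_assoc_germ M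
    using assms la by (simp add: left_assoc_germ_def left_assoc_germ_axioms_def)
  show "garside_germ M \<longleftrightarrow> left_cancellative M \<and> greatest_J M"
  proof (intro iffI conjI)
    assume "left_cancellative M \<and> greatest_J M"
    then interpret J_germ M by unfold_locales auto
    show "garside_germ M" by (rule garside_germ)
  qed (simp_all add: garside_germ_imp_left_cancellative garside_germ_imp_greatest_J)
qed


section \<open>Running time and partial correctness\<close>

text \<open>
  A bound on the running time that can be read off the program text, provided that no loop is run
  more than \<open>n + 1\<close> times. The bound \<open>n + 1\<close> instead of \<open>n\<close> leaves room for the loop that moves
  the entries of a list when an element is inserted.
\<close>

primrec cost :: "nat \<Rightarrow> nat \<Rightarrow> com \<Rightarrow> nat" where
  "cost \<kappa> n Skip = 1"
| "cost \<kappa> n (x ::= e) = 1 + ecost \<kappa> e"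
| "cost \<kappa> n (SetVec x e1 e) = 1 + ecost \<kappa> e1 + ecost \<kappa> e"
| "cost \<kappa> n (SetTab x e1 e2 e) = 1 + ecost \<kappa> e1 + ecost \<kappa> e2 + ecost \<kappa> e"
| "cost \<kappa> n (c1 ;; c2) = cost \<kappa> n c1 + cost \<kappa> n c2"
| "cost \<kappa> n (IF b THEN c1 ELSE c2) = 1 + bcost \<kappa> b + cost \<kappa> n c1 + cost \<kappa> n c2"
| "cost \<kappa> n (FOR x < e DO c) = 2 + ecost \<kappa> e + (n + 1) * (1 + cost \<kappa> n c)"
| "cost \<kappa> n (Return e) = 1 + ecost \<kappa> e"

primrec loop_depth :: "com \<Rightarrow> nat" where
  "loop_depth Skip = 0"
| "loop_depth (x ::= e) = 0"
| "loop_depth (SetVec x e1 e) = 0"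
| "loop_depth (SetTab x e1 e2 e) = 0"
| "loop_depth (c1 ;; c2) = max (loop_depth c1) (loop_depth c2)"
| "loop_depth (IF b THEN c1 ELSE c2) = max (loop_depth c1) (loop_depth c2)"
| "loop_depth (FOR x < e DO c) = Suc (loop_depth c)"
| "loop_depth (Return e) = 0"

lemma cost_le_loop_depth: "\<exists>K. \<forall>n. cost \<kappa> n c \<le> K * (n + 1) ^ loop_depth c"
proof (induction c)
  have max: "\<exists>K. \<forall>n. A + f n + g n \<le> K * (n + 1) ^ max i j"
    if f: "\<forall>n. f n \<le> K1 * (n + 1) ^ i" and g: "\<forall>n. g n \<le> K2 * (n + 1) ^ j"
    for f g :: "nat \<Rightarrow> nat" and A K1 K2 i j
  proof (intro exI allI)
    fix n :: nat
    let ?p = "(n + 1) ^ max i j"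
    have "K1 * (n + 1) ^ i \<le> K1 * ?p" "K2 * (n + 1) ^ j \<le> K2 * ?p" "A * 1 \<le> A * ?p"
      by (intro mult_le_mono2 power_increasing one_le_power; simp)+
    then show "A + f n + g n \<le> (A + K1 + K2) * ?p"
      using f[rule_format, of n] g[rule_format, of n] unfolding add_mult_distrib by linarith
  qed
  {
    case (Seq c1 c2)
    then show ?case using max[where A = 0] by fastforce
  next
    case (Cond b c1 c2)
    then show ?case using max[where A = "1 + bcost \<kappa> b"] by fastforce
  next
    case (For x e c)
    then obtain K where K: "\<And>n. cost \<kappa> n c \<le> K * (n + 1) ^ loop_depth c" by blast
    show ?case
    proof (intro exI allI)
      fix n :: nat
      let ?q = "(n + 1) ^ loop_depth c"
      have "1 \<le> ?q" by simp
      then have "1 + cost \<kappa> n c \<le> (K + 1) * ?q" using K[of n] unfolding add_mult_distrib by linarith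
      then have "(n + 1) * (1 + cost \<kappa> n c) \<le> (n + 1) * ((K + 1) * ?q)" by (rule mult_le_mono2)
      also have "\<dots> = (K + 1) * (n + 1) ^ Suc (loop_depth c)" by (simp add: algebra_simps)
      finally have *: "(n + 1) * (1 + cost \<kappa> n c) \<le> (K + 1) * (n + 1) ^ Suc (loop_depth c)" .
      have "(2 + ecost \<kappa> e) * 1 \<le> (2 + ecost \<kappa> e) * (n + 1) ^ Suc (loop_depth c)"
        by (intro mult_le_mono2 one_le_power) simp
      with * show "cost \<kappa> n (FOR x < e DO c)
          \<le> (2 + ecost \<kappa> e + (K + 1)) * (n + 1) ^ loop_depth (FOR x < e DO c)"
        unfolding add_mult_distrib cost.simps loop_depth.simps by linarith
    qed
  }
qed auto

lemma cost_bigo: "(\<lambda>n. real (cost \<kappa> n c)) \<in> O(\<lambda>n. real n ^ loop_depth c)"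
proof -
  obtain K where K: "\<And>n. cost \<kappa> n c \<le> K * (n + 1) ^ loop_depth c"
    using cost_le_loop_depth by blast
  have "norm (real (cost \<kappa> n c)) \<le> real (K * 2 ^ loop_depth c) * norm (real n ^ loop_depth c)"
    if "n \<ge> 1" for n
  proof -
    have "(n + 1) ^ loop_depth c \<le> (2 * n) ^ loop_depth c"
      using that by (intro power_mono) auto
    then have "K * (n + 1) ^ loop_depth c \<le> K * 2 ^ loop_depth c * n ^ loop_depth c"
      by (simp add: power_mult_distrib)
    then have "cost \<kappa> n c \<le> K * 2 ^ loop_depth c * n ^ loop_depth c"
      using K[of n] by linarith
    then have "real (cost \<kappa> n c) \<le> real (K * 2 ^ loop_depth c * n ^ loop_depth c)"
      by (rule of_nat_mono)
    then show ?thesis by simp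
  qed
  then show ?thesis
    by (intro bigoI[where c = "real (K * 2 ^ loop_depth c)"] eventually_at_top_linorderI) blast
qed

text \<open>
  A precondition for the static time bound and for the postconditions \<open>Q\<close> of a normal end and \<open>R\<close>
  of a \<open>Return\<close>. Tying the time bound to the program text keeps arithmetic out of the correctness
  proofs: time enters them only through the bound on the number of runs of each loop.
\<close>

definition wp :: "nat \<Rightarrow> coded \<Rightarrow> com \<Rightarrow> (state \<Rightarrow> bool) \<Rightarrow> (nat \<Rightarrow> state \<Rightarrow> bool) \<Rightarrow> state \<Rightarrow> bool" where
  "wp \<kappa> M c Q R s \<longleftrightarrow>
     (case exec \<kappa> M c s of (s', r, t) \<Rightarrow>
        t \<le> cost \<kappa> (csize M) c \<and> (case r of None \<Rightarrow> Q s' | Some v \<Rightarrow> R v s'))"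

lemma wp_Skip: "Q s \<Longrightarrow> wp \<kappa> M Skip Q R s"
  by (simp add: wp_def)

lemma wp_Assign: "Q (s\<lparr>var := (var s)(x := eval M s e)\<rparr>) \<Longrightarrow> wp \<kappa> M (x ::= e) Q R s"
  by (simp add: wp_def)

lemma wp_SetVec:
  "Q (s\<lparr>vec := (vec s)(x := (vec s x)(eval M s e1 := eval M s e))\<rparr>)
    \<Longrightarrow> wp \<kappa> M (SetVec x e1 e) Q R s"
  by (simp add: wp_def)

lemma wp_SetTab:
  "Q (s\<lparr>tab := (tab s)(x := (tab s x)(eval M s e1 :=
        (tab s x (eval M s e1))(eval M s e2 := eval M s e)))\<rparr>)
    \<Longrightarrow> wp \<kappa> M (SetTab x e1 e2 e) Q R s"
  by (simp add: wp_def)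

lemma wp_Return: "R (eval M s e) s \<Longrightarrow> wp \<kappa> M (Return e) Q R s"
  by (simp add: wp_def)

lemma wp_Seq: "wp \<kappa> M c1 (wp \<kappa> M c2 Q R) R s \<Longrightarrow> wp \<kappa> M (c1 ;; c2) Q R s"
  by (fastforce simp: wp_def split: prod.splits option.splits)

lemma wp_Cond:
  assumes "beval M s b \<Longrightarrow> wp \<kappa> M c1 Q R s" "\<not> beval M s b \<Longrightarrow> wp \<kappa> M c2 Q R s"
  shows "wp \<kappa> M (IF b THEN c1 ELSE c2) Q R s"
  using assms by (cases "beval M s b") (auto simp: wp_def split: prod.splits option.splits)

lemma wp_mono:
  assumes "wp \<kappa> M c Q R s" "\<And>s. Q s \<Longrightarrow> Q' s" "\<And>v s. R v s \<Longrightarrow> R' v s"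
  shows "wp \<kappa> M c Q' R' s"
  using assms by (auto simp: wp_def split: prod.splits option.splits)

lemma wp_For:
  assumes N: "eval M s e = N" "N \<le> csize M + 1"
    and init: "I 0 s"
    and step: "\<And>i s. i < N \<Longrightarrow> I i s \<Longrightarrow> wp \<kappa> M c (I (Suc i)) R (s\<lparr>var := (var s)(x := i)\<rparr>)"
    and final: "\<And>s. I N s \<Longrightarrow> Q s"
  shows "wp \<kappa> M (FOR x < e DO c) Q R s"
proof -
  define f where "f = (\<lambda>i s. exec \<kappa> M c (s\<lparr>var := (var s)(x := i)\<rparr>))"
  let ?B = "1 + cost \<kappa> (csize M) c"
  have iter: "case iterate f i k s of (s', r, t) \<Rightarrow>
      t \<le> 1 + k * ?B \<and> (case r of None \<Rightarrow> I N s' | Some v \<Rightarrow> R v s')"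
    if "i + k = N" "I i s" for i k s
    using that
  proof (induction k arbitrary: i s)
    case (Suc k)
    obtain s' r t where e: "f i s = (s', r, t)" by (cases "f i s")
    from step[of i s] Suc.prems have st: "wp \<kappa> M c (I (Suc i)) R (s\<lparr>var := (var s)(x := i)\<rparr>)" by simp
    show ?case
    proof (cases r)
      case None
      then have t: "t \<le> cost \<kappa> (csize M) c" and I: "I (Suc i) s'"
        using st e by (auto simp: wp_def f_def)
      have "case iterate f (Suc i) k s' of (s', r, t) \<Rightarrow>
          t \<le> 1 + k * ?B \<and> (case r of None \<Rightarrow> I N s' | Some v \<Rightarrow> R v s')"
        using Suc.prems I by (intro Suc.IH) auto
      with t None e show ?thesis by (auto split: prod.splits)
    next
      case (Some v)
      then show ?thesis using st e by (auto simp: wp_def f_def)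
    qed
  qed simp
  obtain s' r t where e: "iterate f 0 N s = (s', r, t)" by (cases "iterate f 0 N s")
  have "N * ?B \<le> (csize M + 1) * ?B" using N by (intro mult_le_mono1)
  with iter[of 0 N s] init e N final show ?thesis
    by (auto simp: wp_def simp flip: f_def split: option.splits)
qed

lemmas wp_rules = wp_Skip wp_Assign wp_SetVec wp_SetTab wp_Return wp_Seq wp_Cond


text \<open>The form in which comparisons of truth values with \<open>1\<close> occur after simplification.\<close>

lemma of_bool_eq_Suc_0 [simp]: "of_bool P = Suc 0 \<longleftrightarrow> P"
  by simp


section \<open>Codes of germ elements\<close>

locale coded_germ = germ M for M :: "('o, 'a) pmon" +
  fixes es :: "'a list"
  assumes enum: "enumerates es M"
begin

abbreviation "n \<equiv> length es"
abbreviation "C \<equiv> code M es"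
abbreviation "le i j \<equiv> ldiv M (es ! i) (es ! j)"

lemma set_es: "set es = El M" and distinct_es: "distinct es"
  using enum by (auto simp: enumerates_def)

lemma card_El: "card (El M) = n"
  using distinct_card[OF distinct_es] by (simp add: set_es)

lemma csize_C [simp]: "csize C = n"
  by (simp add: code_def)

lemma index_nth [simp]: "i < n \<Longrightarrow> index es (es ! i) = i"
  unfolding index_def by (rule the_equality) (auto simp: nth_eq_iff_index_eq[OF distinct_es])

lemma index_El: "a \<in> El M \<Longrightarrow> index es a < n \<and> es ! index es a = a"
  by (metis in_set_conv_nth index_nth set_es)

lemma nth_El [simp]: "i < n \<Longrightarrow> es ! i \<in> El M"
  using nth_mem set_es by blast

lemma cdef_C: "i < n \<Longrightarrow> j < n \<Longrightarrow> cdef C i j \<longleftrightarrow> (\<exists>c. mul M (es ! i) (es ! j) = Some c)"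
  by (simp add: code_def)

lemma cdef_less: "cdef C i j \<Longrightarrow> i < n \<and> j < n"
  by (simp add: code_def)

lemma cmul_C: "cdef C i j \<Longrightarrow> mul M (es ! i) (es ! j) = Some (es ! cmul C i j)"
  using mul_cod[of "es ! i" "es ! j"] by (auto simp: code_def index_El)

lemma cmul_less: "cdef C i j \<Longrightarrow> cmul C i j < n"
  using mul_cod[of "es ! i" "es ! j"] by (auto simp: code_def index_El)

lemma mul_coded: "mul M (es ! i) (es ! j) = Some (es ! k) \<longleftrightarrow> cdef C i j \<and> cmul C i j = k"
  if "i < n" "j < n" "k < n"
  using that by (metis cdef_C cmul_C cmul_less index_nth option.inject)

lemma ctgt_csrc: "ctgt C i = csrc C j \<longleftrightarrow> tgt M (es ! i) = src M (es ! j)" if "i < n" "j < n"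
proof -
  have "ident M (tgt M (es ! i)) \<in> El M" "ident M (src M (es ! j)) \<in> El M"
    using that by (simp_all add: ident_El src_Ob tgt_Ob)
  then show ?thesis
    using that by (auto simp: code_def) (metis index_El nth_El src_Ob src_ident tgt_Ob)
qed

lemma le_coded: "le i j \<longleftrightarrow> (\<exists>b<n. cdef C i b \<and> cmul C i b = j)" if "i < n" "j < n"
  unfolding ldiv_def using that
  by (metis in_set_conv_nth mul_coded nth_El set_es)

lemma holds_table_coded: "holds_table M es s \<longleftrightarrow> (\<forall>i<n. \<forall>j<n. tab s ''D'' i j = of_bool (le i j))"
  by (simp add: holds_table_def)

end


section \<open>Left-associativity\<close>

definition la_loop :: com where
  "la_loop =
     FOR ''a'' < Size DO
       FOR ''b'' < Size DO
         WHEN Eq (Tgt (V ''a'')) (Src (V ''b'')) DO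
           FOR ''c'' < Size DO
             WHEN Conj (Eq (Tgt (V ''b'')) (Src (V ''c'')))
                    (Conj (Conj (Defd (V ''a'') (V ''b'')) (Defd (Mul (V ''a'') (V ''b'')) (V ''c'')))
                         (Neg (Defd (V ''b'') (V ''c'')))) DO
               Return (Const 0)"

lemma IsLeftAssociative_eq: "IsLeftAssociative = (la_loop ;; Return (Const 1))"
  by (simp add: IsLeftAssociative_def la_loop_def)

context coded_germ
begin

definition bad_triple :: "nat \<Rightarrow> nat \<Rightarrow> nat \<Rightarrow> bool" where
  "bad_triple a b c \<longleftrightarrow> cdef C a b \<and> cdef C (cmul C a b) c \<and> \<not> cdef C b c"

lemma left_associative_coded:
  "left_associative M \<longleftrightarrow> (\<forall>a<n. \<forall>b<n. \<forall>c<n. \<not> bad_triple a b c)"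
proof
  assume "left_associative M"
  then show "\<forall>a<n. \<forall>b<n. \<forall>c<n. \<not> bad_triple a b c"
    unfolding left_associative_def bad_triple_def by (meson cdef_C cmul_C)
next
  assume *: "\<forall>a<n. \<forall>b<n. \<forall>c<n. \<not> bad_triple a b c"
  show "left_associative M"
    unfolding left_associative_def
  proof (intro allI impI, elim conjE)
    fix a b c ab abc
    assume 1: "mul M a b = Some ab" and 2: "mul M ab c = Some abc"
    then have "a \<in> El M" "b \<in> El M" "c \<in> El M" "ab \<in> El M" "abc \<in> El M"
      using mul_dom[OF 1] mul_dom[OF 2] mul_cod[OF 2] by auto
    then obtain i j k l m where "i < n" "j < n" "k < n" "l < n" "m < n"
      "a = es ! i" "b = es ! j" "c = es ! k" "ab = es ! l" "abc = es ! m"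
      by (metis in_set_conv_nth set_es)
    with * 1 2 show "\<exists>bc. mul M b c = Some bc"
      by (auto simp: mul_coded bad_triple_def simp flip: cdef_C)
  qed
qed

text \<open>This is why the loops may skip the pairs that are not composable.\<close>

lemma bad_triple_composable:
  assumes "bad_triple a b c"
  shows "ctgt C a = csrc C b" "ctgt C b = csrc C c"
proof -
  have ab: "cdef C a b" and abc: "cdef C (cmul C a b) c"
    using assms by (auto simp: bad_triple_def)
  from mul_dom[OF cmul_C[OF ab]] show "ctgt C a = csrc C b"
    using cdef_less[OF ab] by (simp add: ctgt_csrc)
  from mul_dom[OF cmul_C[OF abc]] mul_cod[OF cmul_C[OF ab]] show "ctgt C b = csrc C c"
    using cdef_less[OF ab] cdef_less[OF abc] by (simp add: ctgt_csrc)
qed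

lemma wp_la_loop:
  "wp \<kappa> C la_loop (\<lambda>_. left_associative M) (\<lambda>v _. v = 0 \<and> \<not> left_associative M) s"
proof -
  let ?R = "\<lambda>v _. v = 0 \<and> \<not> left_associative M"
  show ?thesis
    unfolding la_loop_def
  proof (rule wp_For[where N = n and I = "\<lambda>i s. \<forall>a<i. \<forall>b<n. \<forall>c<n. \<not> bad_triple a b c"],
      goal_cases)
    case (4 i s)
    then have i: "i < n" "\<forall>a<i. \<forall>b<n. \<forall>c<n. \<not> bad_triple a b c" by auto
    show ?case
    proof (rule wp_For[where N = n and I = "\<lambda>j s. var s ''a'' = i \<and> (\<forall>b<j. \<forall>c<n. \<not> bad_triple i b c)"],
        goal_cases)
      case (4 j s)
      show ?case
      proof (rule wp_Cond, goal_cases)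
        case 1
        show ?case
          by (rule wp_For[where N = n and
                I = "\<lambda>k s. var s ''a'' = i \<and> var s ''b'' = j \<and> (\<forall>b<j. \<forall>c<n. \<not> bad_triple i b c)
                       \<and> (\<forall>c<k. \<not> bad_triple i j c)"])
             (use 1 4 i in \<open>auto intro!: wp_rules simp: left_associative_coded less_Suc_eq
                bad_triple_composable\<close>, auto simp: bad_triple_def)
      next
        case 2
        with 4 i show ?case
          by (auto intro!: wp_rules simp: less_Suc_eq bad_triple_composable)
      qed
    qed (use i in \<open>auto simp: less_Suc_eq\<close>)
  qed (auto simp: left_associative_coded)
qed

end


section \<open>Left-cancellativity and left-divisibility\<close>

definition ld_loop :: com where
  "ld_loop =
     FOR ''a'' < Size DO (
       FOR ''b'' < Size DO
         SetTab ''D'' (V ''a'') (V ''b'') (Const 0) ;;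
       FOR ''b'' < Size DO
         WHEN Defd (V ''a'') (V ''b'') DO
           IF Eq (Tab ''D'' (V ''a'') (Mul (V ''a'') (V ''b''))) (Const 1)
           THEN Return (Const 0)
           ELSE SetTab ''D'' (V ''a'') (Mul (V ''a'') (V ''b'')) (Const 1))"

lemma LeftDivisibility_eq: "LeftDivisibility = (ld_loop ;; Return (Const 1))"
  by (simp add: LeftDivisibility_def ld_loop_def)

context coded_germ
begin

definition inj_mul_below :: "nat \<Rightarrow> nat \<Rightarrow> bool" where
  "inj_mul_below a k \<longleftrightarrow>
     (\<forall>b<k. \<forall>b'<k. cdef C a b \<and> cdef C a b' \<and> cmul C a b = cmul C a b' \<longrightarrow> b = b')"

lemma left_cancellative_coded: "left_cancellative M \<longleftrightarrow> (\<forall>a<n. inj_mul_below a n)"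
proof
  assume "left_cancellative M"
  then show "\<forall>a<n. inj_mul_below a n"
    unfolding left_cancellative_def inj_mul_below_def by (metis cmul_C index_nth)
next
  assume *: "\<forall>a<n. inj_mul_below a n"
  show "left_cancellative M"
    unfolding left_cancellative_def
  proof (intro allI impI, elim conjE)
    fix a b b' c
    assume 1: "mul M a b = Some c" and 2: "mul M a b' = Some c"
    then have "a \<in> El M" "b \<in> El M" "b' \<in> El M" "c \<in> El M"
      using mul_dom[OF 1] mul_dom[OF 2] mul_cod[OF 2] by auto
    then obtain i j k l where "i < n" "j < n" "k < n" "l < n"
      "a = es ! i" "b = es ! j" "b' = es ! k" "c = es ! l"
      by (metis in_set_conv_nth set_es)
    with * 1 2 show "b = b'"
      by (auto simp: mul_coded inj_mul_below_def)
  qed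
qed

lemma wp_ld_loop:
  "wp \<kappa> C ld_loop (\<lambda>s. left_cancellative M \<and> holds_table M es s)
     (\<lambda>v _. v = 0 \<and> \<not> left_cancellative M) s"
  unfolding ld_loop_def
proof (rule wp_For[where N = n and I = "\<lambda>i s. \<forall>a<i. inj_mul_below a n \<and>
      (\<forall>j<n. tab s ''D'' a j = of_bool (le a j))"], goal_cases)
  case (4 i s)
  define rows where "rows s \<longleftrightarrow> (\<forall>a<i. inj_mul_below a n \<and>
      (\<forall>j<n. tab s ''D'' a j = of_bool (le a j)))" for s :: state
  have i: "i < n" and s: "rows s" using 4 by (auto simp: rows_def)
  show ?case
  proof (intro wp_Seq, rule wp_For[where N = n and
      I = "\<lambda>j s. var s ''a'' = i \<and> rows s \<and> (\<forall>b<j. tab s ''D'' i b = 0)"], goal_cases)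
    case (5 s)
    have "wp \<kappa> C (FOR ''b'' < Size DO
         WHEN Defd (V ''a'') (V ''b'') DO
           IF Eq (Tab ''D'' (V ''a'') (Mul (V ''a'') (V ''b''))) (Const 1)
           THEN Return (Const 0)
           ELSE SetTab ''D'' (V ''a'') (Mul (V ''a'') (V ''b'')) (Const 1))
         (\<lambda>s. rows s \<and> inj_mul_below i n \<and> (\<forall>j<n. tab s ''D'' i j = of_bool (le i j)))
         (\<lambda>v _. v = 0 \<and> \<not> left_cancellative M) s"
    proof (rule wp_For[where N = n and
        I = "\<lambda>k s. var s ''a'' = i \<and> rows s \<and> inj_mul_below i k \<and>
               (\<forall>j<n. tab s ''D'' i j = of_bool (\<exists>b<k. cdef C i b \<and> cmul C i b = j))"], goal_cases)
      case (4 k s)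
      then have rows: "var s ''a'' = i" "rows s" and k: "k < n" and inj: "inj_mul_below i k"
        and row: "\<And>j. j < n \<Longrightarrow> tab s ''D'' i j = of_bool (\<exists>b<k. cdef C i b \<and> cmul C i b = j)"
        by auto
      show ?case
      proof (intro wp_rules, goal_cases)
        case 1
        \<comment> \<open>the product \<open>a \<bullet> b\<close> has been met before, with another \<open>b\<close>\<close>
        then have def: "cdef C i k" "tab s ''D'' i (cmul C i k) = 1" using rows by auto
        then obtain b where "b < k" "cdef C i b" "cmul C i b = cmul C i k"
          using row[OF cmul_less[OF def(1)]] by auto
        moreover from this have "b < n" "b \<noteq> k" using k by auto
        ultimately have "\<not> inj_mul_below i n"
          using k def(1) unfolding inj_mul_below_def by blast
        then show ?case using i by (auto simp: left_cancellative_coded)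
      next
        case 2
        then have def: "cdef C i k" "tab s ''D'' i (cmul C i k) \<noteq> 1" using rows by auto
        then have new: "\<not> (\<exists>b<k. cdef C i b \<and> cmul C i b = cmul C i k)"
          using row[OF cmul_less[OF def(1)]] by auto
        then have "inj_mul_below i (Suc k)"
          using inj by (auto simp: inj_mul_below_def less_Suc_eq)
        then show ?case using rows row def by (auto simp: rows_def less_Suc_eq)
      next
        case 3
        then show ?case using rows row inj by (auto simp: rows_def inj_mul_below_def less_Suc_eq)
      qed
    qed (use 5 i in \<open>auto simp: inj_mul_below_def le_coded\<close>)
    then show ?case
      by (rule wp_mono) (auto simp: rows_def less_Suc_eq)
  qed (use s in \<open>auto intro!: wp_rules simp: rows_def less_Suc_eq\<close>)
qed (auto simp: left_cancellative_coded holds_table_coded)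

end


section \<open>Non-ascending enumerations\<close>

definition na_body :: com where
  "na_body =
       ''pos'' ::= V ''len'' ;;
       ''found'' ::= Const 0 ;;
       FOR ''i'' < V ''len'' DO
         WHEN Conj (Eq (V ''found'') (Const 0))
                (Conj (Eq (Tab ''D'' (Vec ''L'' (V ''i'')) (V ''a'')) (Const 1))
                     (Neg (Eq (Tab ''D'' (V ''a'') (Vec ''L'' (V ''i''))) (Const 1)))) DO (
           ''pos'' ::= V ''i'' ;;
           ''found'' ::= Const 1) ;;
       ''cur'' ::= V ''a'' ;;
       FOR ''i'' < SUC (V ''len'') DO
         WHEN Neg (Less (V ''i'') (V ''pos'')) DO (
           ''next'' ::= Vec ''L'' (V ''i'') ;;
           SetVec ''L'' (V ''i'') (V ''cur'') ;;
           ''cur'' ::= V ''next'') ;;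
       ''len'' ::= SUC (V ''len'')"

lemma NonAscending_eq: "NonAscending = (''len'' ::= Const 0 ;; FOR ''a'' < Size DO na_body)"
  by (simp add: NonAscending_def na_body_def)

text \<open>
  Nothing strictly below \<open>a\<close> may precede \<open>a\<close>: this is the choice of the position. Nothing
  strictly above \<open>a\<close> may follow \<open>a\<close>: it would also lie strictly above the entry at that position,
  and this is where transitivity is needed.
\<close>

lemma non_ascending_insert:
  assumes "non_ascending M as" "transp (ldiv M)" "p \<le> length as"
    and before: "\<And>j. j < p \<Longrightarrow> \<not> sldiv M (as ! j) a"
    and at: "p < length as \<Longrightarrow> sldiv M (as ! p) a"
  shows "non_ascending M (take p as @ a # drop p as)"
proof -
  have after: "\<not> sldiv M a (as ! j)" if "p \<le> j" "j < length as" for j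
  proof
    assume a: "sldiv M a (as ! j)"
    then have "sldiv M (as ! p) (as ! j)"
      using at that transpD[OF assms(2)] by (metis le_less_trans sldiv_def)
    moreover have "p \<noteq> j"
      using a at that by (auto simp: sldiv_def)
    ultimately show False
      using assms(1) that by (auto simp: non_ascending_def)
  qed
  show ?thesis
    unfolding non_ascending_def
  proof (intro allI impI)
    fix i j assume ij: "i < j \<and> j < length (take p as @ a # drop p as)"
    consider "j < p" | "j = p" | "i < p" "p < j" | "i = p" | "p < i" using ij by linarith
    then show "\<not> sldiv M ((take p as @ a # drop p as) ! i) ((take p as @ a # drop p as) ! j)"
    proof cases
      case 3
      with ij assms(3) have "(take p as @ a # drop p as) ! i = as ! i"
        "(take p as @ a # drop p as) ! j = as ! (j - 1)"
        by (auto simp: nth_append nth_Cons' min_def)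
      moreover have "i < j - 1" "j - 1 < length as" using 3 ij assms(3) by auto
      ultimately show ?thesis using assms(1) by (simp add: non_ascending_def)
    next
      case 5
      with ij assms(3) have "(take p as @ a # drop p as) ! i = as ! (i - 1)"
        "(take p as @ a # drop p as) ! j = as ! (j - 1)"
        by (auto simp: nth_append nth_Cons' min_def)
      moreover have "i - 1 < j - 1" "j - 1 < length as" using 5 ij assms(3) by auto
      ultimately show ?thesis using assms(1) by (simp add: non_ascending_def)
    qed (use ij assms(1,3) before after in
      \<open>auto simp: nth_append nth_Cons' min_def non_ascending_def\<close>)
  qed
qed

context coded_germ
begin

definition less_coded :: "nat \<Rightarrow> nat \<Rightarrow> bool" where
  "less_coded i j \<longleftrightarrow> le i j \<and> \<not> le j i"

text \<open>
  The list in the array \<open>L\<close> as a list of codes, together with the table that all comparisons rely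
  on and the bound that keeps the loops over the list short.
\<close>

definition stores :: "nat list \<Rightarrow> state \<Rightarrow> bool" where
  "stores xs s \<longleftrightarrow> holds_table M es s \<and> set xs \<subseteq> {..<n} \<and> length xs \<le> n
     \<and> var s ''len'' = length xs \<and> (\<forall>i<length xs. vec s ''L'' i = xs ! i)"

lemma holds_table_upd [simp]:
  "holds_table M es (s\<lparr>var := f\<rparr>) = holds_table M es s"
  "holds_table M es (s\<lparr>vec := g\<rparr>) = holds_table M es s"
  by (simp_all add: holds_table_def)

lemma stores_upd [simp]:
  "f ''len'' = var s ''len'' \<Longrightarrow> stores xs (s\<lparr>var := f\<rparr>) = stores xs s"
  by (simp add: stores_def)

lemma stores_holds_list: "stores xs s \<Longrightarrow> holds_list es (map ((!) es) xs) s"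
  by (auto simp: stores_def holds_list_def subset_iff)

lemma wp_na_body:
  assumes "stores xs s" "length xs < n" "var s ''a'' = a" "a < n"
    and Q: "\<And>p s. p \<le> length xs \<Longrightarrow> (\<And>j. j < p \<Longrightarrow> \<not> less_coded (xs ! j) a)
      \<Longrightarrow> (p < length xs \<Longrightarrow> less_coded (xs ! p) a)
      \<Longrightarrow> stores (take p xs @ a # drop p xs) s \<Longrightarrow> Q s"
  shows "wp \<kappa> C na_body Q R s"
proof -
  let ?l = "length xs"
  define pos_at where "pos_at k p f \<longleftrightarrow> (\<forall>j<min k p. \<not> less_coded (xs ! j) a) \<and>
      (if f = 0 then p = ?l else p < k \<and> less_coded (xs ! p) a)" for k p f :: nat
  have D: "tab s ''D'' i j = of_bool (le i j)" if "stores xs s" "i < n" "j < n" for s i j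
    using that by (auto simp: stores_def holds_table_coded)
  have L: "vec s ''L'' i = xs ! i" "xs ! i < n" if "stores xs s" "i < ?l" for s i
    using that by (auto simp: stores_def subset_iff)
  show ?thesis
    unfolding na_body_def
  proof (intro wp_Seq wp_Assign, rule wp_For[where N = ?l and
      I = "\<lambda>k s. stores xs s \<and> var s ''a'' = a \<and> pos_at k (var s ''pos'') (var s ''found'')"],
      goal_cases)
    case (4 k s)
    then have s: "stores xs s" "var s ''a'' = a" "pos_at k (var s ''pos'') (var s ''found'')"
      and k: "k < ?l" by auto
    show ?case
    proof (intro wp_rules, goal_cases)
      case 1
      then have "less_coded (xs ! k) a" "var s ''found'' = 0"
        using s k \<open>a < n\<close> L[OF s(1) k] by (auto simp: D less_coded_def)
      then show ?case using s k by (auto simp: pos_at_def)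
    next
      case 2
      then have "\<not> less_coded (xs ! k) a \<or> var s ''found'' \<noteq> 0"
        using s k \<open>a < n\<close> L[OF s(1) k] by (auto simp: D less_coded_def)
      then show ?case
        using s k by (auto simp: pos_at_def less_Suc_eq split: if_splits)
    qed
  next
    case (5 s)
    then have s: "stores xs s" "var s ''a'' = a"
      and pos: "pos_at ?l (var s ''pos'') (var s ''found'')" by auto
    define p where "p = var s ''pos''"
    have p: "p \<le> ?l" "\<And>j. j < p \<Longrightarrow> \<not> less_coded (xs ! j) a" "p < ?l \<Longrightarrow> less_coded (xs ! p) a"
      using pos by (auto simp: p_def pos_at_def split: if_splits)
    let ?new = "take p xs @ a # drop p xs"
    \<comment> \<open>In the last run \<open>cur\<close> receives the content of the cell behind the list.\<close>
    show ?case
    proof (intro wp_Seq wp_Assign, rule wp_For[where N = "Suc ?l" and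
        I = "\<lambda>k s. holds_table M es s \<and> var s ''len'' = ?l \<and> var s ''pos'' = p
               \<and> (\<forall>i<k. vec s ''L'' i = ?new ! i) \<and> (\<forall>i<?l. k \<le> i \<longrightarrow> vec s ''L'' i = xs ! i)
               \<and> (k \<le> ?l \<longrightarrow> var s ''cur'' = (if k \<le> p then a else xs ! (k - 1)))"], goal_cases)
      case (4 k s)
      then show ?case
        using p(1)
        by (intro wp_rules)
           (auto simp: nth_append nth_Cons' less_Suc_eq min_def split: if_splits)
    next
      case (5 s)
      show ?case
        by (rule wp_Assign, rule Q[OF p]) (use 5 p(1) assms(1,2,4) in
          \<open>auto simp: stores_def less_Suc_eq_le dest: in_set_takeD in_set_dropD\<close>)
    qed (use s assms(1-4) p(1) in \<open>auto simp: stores_def p_def\<close>)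
  qed (use assms(1-4) in \<open>auto simp: stores_def pos_at_def\<close>)
qed

definition sorted_enum :: "nat list \<Rightarrow> bool" where
  "sorted_enum xs \<longleftrightarrow> distinct xs \<and> set xs = {..<n}
     \<and> (transp (ldiv M) \<longrightarrow> non_ascending M (map ((!) es) xs))"

lemma wp_NonAscending:
  assumes "holds_table M es s"
  shows "wp \<kappa> C NonAscending (\<lambda>s. \<exists>xs. stores xs s \<and> sorted_enum xs) R s"
  unfolding NonAscending_eq
proof (intro wp_Seq wp_Assign, rule wp_For[where N = n and
    I = "\<lambda>k s. \<exists>xs. stores xs s \<and> distinct xs \<and> set xs = {..<k} \<and>
      (transp (ldiv M) \<longrightarrow> non_ascending M (map ((!) es) xs))"], goal_cases)
  case (4 k s)
  then obtain xs where xs: "stores xs s" "distinct xs" "set xs = {..<k}"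
    "transp (ldiv M) \<longrightarrow> non_ascending M (map ((!) es) xs)" and k: "k < n" by auto
  then have len: "length xs = k" using distinct_card[OF xs(2)] xs(3) by simp
  show ?case
  proof (rule wp_na_body[where xs = xs and a = k], goal_cases)
    case (5 p s)
    let ?new = "take p xs @ k # drop p xs"
    have "non_ascending M (take p (map ((!) es) xs) @ es ! k # drop p (map ((!) es) xs))"
      if "transp (ldiv M)"
      using that xs(4) 5(1-3)
      by (intro non_ascending_insert) (auto simp: less_coded_def sldiv_def)
    then have 1: "transp (ldiv M) \<longrightarrow> non_ascending M (map ((!) es) ?new)"
      by (simp add: take_map drop_map)
    have set: "set (take p xs) \<union> set (drop p xs) = {..<k}"
      using xs(3) by (metis append_take_drop_id set_append)
    have "k \<notin> set (take p xs)" "k \<notin> set (drop p xs)"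
      using set by blast+
    then have 2: "distinct ?new"
      using xs(2) by (simp add: set_take_disj_set_drop_if_distinct)
    have 3: "set ?new = {..<Suc k}" using set by (simp add: lessThan_Suc)
    from 5(4) 1 2 3 show ?case by blast
  qed (use xs k len in \<open>auto simp: stores_def\<close>)
next
  case 3
  show ?case
    using assms by (intro exI[of _ "[]"]) (auto simp: stores_def non_ascending_def)
qed (auto simp: sorted_enum_def)

lemma sorted_enum_map:
  assumes "sorted_enum xs"
  shows "distinct (map ((!) es) xs)" "set (map ((!) es) xs) = El M"
proof -
  have xs: "distinct xs" "set xs = {..<n}" using assms by (simp_all add: sorted_enum_def)
  have "inj_on ((!) es) {..<n}" by (simp add: inj_on_def nth_eq_iff_index_eq[OF distinct_es])
  then show "distinct (map ((!) es) xs)" using xs by (simp add: distinct_map)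
  have "(!) es ` {..<n} = set es" by (auto simp: set_conv_nth)
  then show "set (map ((!) es) xs) = El M" by (simp add: xs(2) set_es)
qed

end


section \<open>Greatest elements\<close>

definition j_loop :: com where
  "j_loop =
     FOR ''i'' < V ''len'' DO (
       ''b'' ::= Vec ''L'' (V ''i'') ;;
       WHEN Conj (Defd (V ''a1'') (V ''b'')) (Eq (Tab ''D'' (V ''b'') (V ''a2'')) (Const 1)) DO
         IF Eq (V ''found'') (Const 0)
         THEN (''c'' ::= V ''b'' ;; ''found'' ::= Const 1)
         ELSE WHEN Neg (Eq (Tab ''D'' (V ''b'') (V ''c'')) (Const 1)) DO
           Return (Const 0))"

lemma JHasGreatestElement_eq:
  "JHasGreatestElement = (''found'' ::= Const 0 ;; j_loop ;; Return (Const 1))"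
  by (simp add: JHasGreatestElement_def j_loop_def)

text \<open>
  A scan that meets no entry in \<open>J\<close> would report a greatest element; but \<open>J\<close> is never empty.
\<close>

lemma (in germ) ident_JS:
  assumes "a1 \<in> El M" "a2 \<in> El M" "tgt M a1 = src M a2"
  shows "ident M (src M a2) \<in> JS M a1 a2"
  using assms mul_ident[of a1] ident_mul[of a2] ident_El[of "src M a2"] src_Ob[of a2]
  by (auto simp: JS_def ldiv_def)

text \<open>
  If \<open>as ! p\<close> is the first entry in \<open>J\<close> and \<open>g\<close> the greatest element, then \<open>g\<close> comes no earlier
  than \<open>as ! p\<close> and is not strictly above it, so that it divides it in turn.
\<close>

lemma first_entry_greatest:
  assumes "transp (ldiv M)" "non_ascending M as" "J \<subseteq> set as" "p < length as"
    and first: "\<And>j. j < p \<Longrightarrow> as ! j \<notin> J" "as ! p \<in> J"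
    and g: "is_greatest M J g" and b: "b \<in> J"
  shows "ldiv M b (as ! p)"
proof -
  have bg: "ldiv M b g" "ldiv M (as ! p) g" and "g \<in> J"
    using g b first(2) by (auto simp: is_greatest_def)
  then obtain m where m: "m < length as" "g = as ! m"
    using assms(3) by (metis in_set_conv_nth subsetD)
  have "p \<le> m" using first(1)[of m] \<open>g \<in> J\<close> m by force
  then show ?thesis
    using bg m assms(2) transpD[OF assms(1) bg(1)]
    by (cases "p = m") (auto simp: non_ascending_def sldiv_def)
qed

context coded_germ
begin

lemma wp_j_loop:
  fixes i j :: nat
  defines "J \<equiv> JS M (es ! i) (es ! j)"
  assumes s: "stores xs s" "var s ''a1'' = i" "var s ''a2'' = j" "var s ''found'' = 0"
    and ij: "i < n" "j < n" "tgt M (es ! i) = src M (es ! j)"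
    and xs: "set xs = {..<n}" "transp (ldiv M) \<Longrightarrow> non_ascending M (map ((!) es) xs)"
  shows "wp \<kappa> C j_loop
     (\<lambda>s. stores xs s \<and> var s ''a1'' = i \<and> var s ''a2'' = j \<and> (\<exists>c. is_greatest M J c))
     (\<lambda>v s. transp (ldiv M) \<longrightarrow> v = 0 \<and> \<not> (\<exists>c. is_greatest M J c)) s"
proof -
  let ?as = "map ((!) es) xs"
  have J: "es ! b \<in> J \<longleftrightarrow> cdef C i b \<and> le b j" if "b < n" for b
    using that ij by (auto simp: J_def JS_def cdef_C)
  have less: "xs ! k < n" if "k < length xs" for k
    using that xs(1) nth_mem by blast
  have D: "tab s ''D'' b c = of_bool (le b c)" if "stores xs s" "b < n" "c < n" for s b c
    using that by (auto simp: stores_def holds_table_coded)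
  have L: "vec s ''L'' k = xs ! k" if "stores xs s" "k < length xs" for s k
    using that by (auto simp: stores_def)
  have J_sub: "J \<subseteq> set ?as"
    using xs(1) by (auto simp: J_def JS_def set_es[symmetric] in_set_conv_nth image_iff)
  define fst_in where "fst_in k p \<longleftrightarrow> p < k \<and> es ! (xs ! p) \<in> J \<and> (\<forall>l<p. es ! (xs ! l) \<notin> J)
      \<and> (\<forall>l<k. es ! (xs ! l) \<in> J \<longrightarrow> le (xs ! l) (xs ! p))" for k p
  define inv where "inv k s \<longleftrightarrow> stores xs s \<and> var s ''a1'' = i \<and> var s ''a2'' = j
      \<and> (if var s ''found'' = 0 then \<forall>l<k. es ! (xs ! l) \<notin> J
         else \<exists>p. fst_in k p \<and> var s ''c'' = xs ! p)" for k s
  show ?thesis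
    unfolding j_loop_def
  proof (rule wp_For[where N = "length xs" and I = inv], goal_cases)
    case (4 k s)
    then have k: "k < length xs" and st: "stores xs s" "var s ''a1'' = i" "var s ''a2'' = j"
      and inv: "if var s ''found'' = 0 then \<forall>l<k. es ! (xs ! l) \<notin> J
         else \<exists>p. fst_in k p \<and> var s ''c'' = xs ! p"
      by (auto simp: inv_def)
    note simps = D[OF st(1)] L[OF st(1) k] less[OF k] J[OF less[OF k]] st ij
    show ?case
    proof (intro wp_rules, goal_cases)
      case 1
      then have "var s ''found'' = 0" "es ! (xs ! k) \<in> J"
        using simps by simp_all
      moreover from this have "\<forall>l<k. es ! (xs ! l) \<notin> J" using inv by simp
      ultimately have "fst_in (Suc k) k"
        using ldiv_refl[OF nth_El[OF less[OF k]]] unfolding fst_in_def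
        by (simp add: less_Suc_eq)
      then show ?case using st simps(2) by (auto simp: inv_def)
    next
      case 2
      then have f: "var s ''found'' \<noteq> 0" and kJ: "es ! (xs ! k) \<in> J"
        using simps by simp_all
      then obtain p where p: "fst_in k p" "var s ''c'' = xs ! p" using inv by auto
      then have "p < length xs" using k by (auto simp: fst_in_def)
      then have nle: "\<not> le (xs ! k) (xs ! p)" using 2 p less[of p] simps by simp
      show ?case
      proof (intro impI conjI notI)
        assume t: "transp (ldiv M)" and "\<exists>c. is_greatest M J c"
        then obtain g where g: "is_greatest M J g" by blast
        have "ldiv M (es ! (xs ! k)) (?as ! p)"
          by (rule first_entry_greatest[OF t xs(2)[OF t] J_sub _ _ _ g kJ])
             (use p \<open>p < length xs\<close> in \<open>auto simp: fst_in_def\<close>)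
        with nle \<open>p < length xs\<close> show False by simp
      qed simp
    next
      case 3
      then have f: "var s ''found'' \<noteq> 0" using simps by simp_all
      then obtain p where p: "fst_in k p" "var s ''c'' = xs ! p" using inv by auto
      then have "p < length xs" using k by (auto simp: fst_in_def)
      then have "le (xs ! k) (xs ! p)" using 3 p less[of p] simps by simp
      then have "fst_in (Suc k) p" using p by (auto simp: fst_in_def less_Suc_eq)
      then show ?case using simps f p by (auto simp: inv_def)
    next
      case 4
      then have kJ: "es ! (xs ! k) \<notin> J" using simps by auto
      then have suc: "fst_in k p \<Longrightarrow> fst_in (Suc k) p" for p
        by (auto simp: fst_in_def less_Suc_eq)
      show ?case
      proof (cases "var s ''found'' = 0")
        case True
        then show ?thesis using st inv kJ by (auto simp: inv_def less_Suc_eq)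
      next
        case False
        with inv obtain p where "fst_in k p" "var s ''c'' = xs ! p" by auto
        with suc[of p] st False show ?thesis by (auto simp: inv_def)
      qed
    qed
  next
    case (5 s)
    have J_nth: "\<exists>m<length xs. b = es ! (xs ! m)" if b: "b \<in> J" for b
    proof -
      from b J_sub have "b \<in> set ?as" by blast
      then show ?thesis by (auto simp: in_set_conv_nth)
    qed
    have "ident M (src M (es ! j)) \<in> J"
      unfolding J_def by (rule ident_JS[OF nth_El[OF ij(1)] nth_El[OF ij(2)] ij(3)])
    with J_nth obtain m where m: "m < length xs" "es ! (xs ! m) \<in> J" by metis
    have "var s ''found'' \<noteq> 0"
      using 5 m unfolding inv_def by meson
    then obtain p where p: "fst_in (length xs) p"
      using 5 unfolding inv_def by auto
    have "ldiv M b (es ! (xs ! p))" if "b \<in> J" for b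
      using J_nth[OF that] p that unfolding fst_in_def by blast
    then have "is_greatest M J (es ! (xs ! p))"
      using p by (simp add: is_greatest_def fst_in_def)
    then show ?case using 5 unfolding inv_def by blast
  qed (use s xs in \<open>auto simp: stores_def inv_def\<close>)
qed

end


section \<open>Testing for Garside germs\<close>

text \<open>
  As \<open>Return\<close> ends a program, the loops are strung together without the final \<open>Return\<close> of each
  function: the program goes on as long as no obstacle is found.
\<close>

definition is_garside_test :: com where
  "is_garside_test =
     la_loop ;;
     ld_loop ;;
     NonAscending ;;
     FOR ''a1'' < Size DO
       FOR ''a2'' < Size DO
         WHEN Eq (Tgt (V ''a1'')) (Src (V ''a2'')) DO (
           ''found'' ::= Const 0 ;;
           j_loop) ;;
     Return (Const 1)"

context coded_germ
begin

lemma greatest_J_coded: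
  "greatest_J M \<longleftrightarrow> (\<forall>i<n. \<forall>j<n. ctgt C i = csrc C j \<longrightarrow>
     (\<exists>c. is_greatest M (JS M (es ! i) (es ! j)) c))"
  unfolding greatest_J_def set_es[symmetric] all_set_conv_all_nth by (simp add: ctgt_csrc)

lemma wp_is_garside_test:
  "wp \<kappa> C is_garside_test (\<lambda>_. False)
     (\<lambda>v _. v = of_bool (left_associative M \<and> left_cancellative M \<and> greatest_J M)) s"
proof -
  let ?R = "\<lambda>v _. v = of_bool (left_associative M \<and> left_cancellative M \<and> greatest_J M)"
  define G where "G i j \<longleftrightarrow> (ctgt C i = csrc C j \<longrightarrow>
      (\<exists>c. is_greatest M (JS M (es ! i) (es ! j)) c))" for i j
  have J_loops: "wp \<kappa> C (FOR ''a1'' < Size DO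
       FOR ''a2'' < Size DO
         WHEN Eq (Tgt (V ''a1'')) (Src (V ''a2'')) DO (
           ''found'' ::= Const 0 ;;
           j_loop)) (\<lambda>_. greatest_J M) ?R s"
    if "left_associative M" "stores xs s" "sorted_enum xs" for s xs
  proof -
    have tr: "transp (ldiv M)"
      using left_associative_imp_transp_ldiv germ_axioms that(1) by blast
    show ?thesis
    proof (rule wp_For[where N = n and I = "\<lambda>k s. stores xs s \<and> (\<forall>i<k. \<forall>j<n. G i j)"], goal_cases)
      case (4 i s)
      then have i: "i < n" "\<forall>i'<i. \<forall>j<n. G i' j" by auto
      show ?case
      proof (rule wp_For[where N = n and
          I = "\<lambda>k s. stores xs s \<and> var s ''a1'' = i \<and> (\<forall>j<k. G i j)"], goal_cases)
        case (4 j s)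
        show ?case
        proof (intro wp_Cond wp_Seq wp_Assign wp_Skip, goal_cases)
          case 1
          then have comp: "ctgt C i = csrc C j" using 4 by simp
          moreover have "j < n" using 4 by simp
          ultimately have comp': "tgt M (es ! i) = src M (es ! j)" using i by (simp add: ctgt_csrc)
          have G: "\<exists>c. is_greatest M (JS M (es ! i) (es ! j)) c \<Longrightarrow> G i j"
            by (simp add: G_def)
          have not_G: "greatest_J M \<Longrightarrow> \<exists>c. is_greatest M (JS M (es ! i) (es ! j)) c"
            using comp i(1) \<open>j < n\<close> unfolding greatest_J_coded by blast
          show ?case
          proof (rule wp_mono, rule wp_j_loop[where xs = xs and i = i and j = j])
            fix v :: nat assume "transp (ldiv M) \<longrightarrow> v = 0 \<and> \<not> (\<exists>c. is_greatest M (JS M (es ! i) (es ! j)) c)"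
            then show "v = of_bool (left_associative M \<and> left_cancellative M \<and> greatest_J M)"
              using tr not_G by auto
          qed (use that(3) 4 i tr comp' G in \<open>auto simp: sorted_enum_def less_Suc_eq\<close>)
        next
          case 2
          then show ?case using 4 by (auto simp: G_def less_Suc_eq)
        qed
      qed (use 4 in \<open>auto simp: less_Suc_eq\<close>)
    qed (use that in \<open>auto simp: greatest_J_coded G_def\<close>)
  qed
  show ?thesis
    unfolding is_garside_test_def
  proof (intro wp_Seq, rule wp_mono[OF wp_la_loop], goal_cases)
    case (1 s)
    show ?case
    proof (intro wp_Seq, rule wp_mono[OF wp_ld_loop], goal_cases)
      case (1 s)
      then have lc: "left_cancellative M" and "holds_table M es s" by auto
      show ?case
      proof (intro wp_Seq, rule wp_mono[OF wp_NonAscending[where R = ?R]], goal_cases)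
        case (2 s)
        then obtain xs where "stores xs s" "sorted_enum xs" by blast
        then show ?case
          by (intro wp_Seq wp_mono[OF J_loops[OF \<open>left_associative M\<close>]] wp_Return)
             (use lc \<open>left_associative M\<close> in auto)
      qed (use \<open>holds_table M es s\<close> in auto)
    qed auto
  qed auto
qed

end


section \<open>Decision procedures and their running times\<close>

lemma cost_bigo_depth: "loop_depth c = d \<Longrightarrow> (\<lambda>n. real (cost \<kappa> n c)) \<in> O(\<lambda>n. real n ^ d)"
  using cost_bigo by blast

context coded_germ
begin

lemma exec_wp:
  assumes "exec \<kappa> C c s = (s', r, t)" "wp \<kappa> C c Q R s"
  shows "(case r of None \<Rightarrow> Q s' | Some v \<Rightarrow> R v s') \<and> real t \<le> real (cost \<kappa> (card (El M)) c)"
  using assms by (auto simp: wp_def card_El split: option.splits)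

lemma IsLeftAssociative_correct:
  assumes "exec \<kappa> C IsLeftAssociative s = (s', r, t)"
  shows "r = Some (of_bool (left_associative M))
    \<and> real t \<le> real (cost \<kappa> (card (El M)) IsLeftAssociative)"
proof -
  have "wp \<kappa> C IsLeftAssociative (\<lambda>_. False) (\<lambda>v _. v = of_bool (left_associative M)) s"
    unfolding IsLeftAssociative_eq by (intro wp_Seq wp_mono[OF wp_la_loop] wp_Return) auto
  from exec_wp[OF assms this] show ?thesis by (auto split: option.splits)
qed

lemma LeftDivisibility_correct:
  assumes "exec \<kappa> C LeftDivisibility s = (s', r, t)"
  shows "r = Some (of_bool (left_cancellative M)) \<and> (left_cancellative M \<longrightarrow> holds_table M es s')
    \<and> real t \<le> real (cost \<kappa> (card (El M)) LeftDivisibility)"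
proof -
  have "wp \<kappa> C LeftDivisibility (\<lambda>_. False)
      (\<lambda>v s. v = of_bool (left_cancellative M) \<and> (left_cancellative M \<longrightarrow> holds_table M es s)) s"
    unfolding LeftDivisibility_eq by (intro wp_Seq wp_mono[OF wp_ld_loop] wp_Return) auto
  from exec_wp[OF assms this] show ?thesis by (auto split: option.splits)
qed

lemma NonAscending_correct:
  assumes "holds_table M es s" "exec \<kappa> C NonAscending s = (s', r, t)"
  shows "(\<exists>as. holds_list es as s' \<and> distinct as \<and> set as = El M \<and>
      (transp (ldiv M) \<longrightarrow> non_ascending M as))
    \<and> real t \<le> real (cost \<kappa> (card (El M)) NonAscending)"
proof -
  from exec_wp[OF assms(2) wp_NonAscending[OF assms(1), where R = "\<lambda>_ _. False"]]
  obtain xs where xs: "stores xs s'" "sorted_enum xs"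
    and t: "real t \<le> real (cost \<kappa> (card (El M)) NonAscending)"
    by (auto split: option.splits)
  then show ?thesis
    using stores_holds_list[OF xs(1)] sorted_enum_map[OF xs(2)] by (auto simp: sorted_enum_def)
qed

lemma JHasGreatestElement_correct:
  assumes a: "a1 \<in> El M" "a2 \<in> El M" "tgt M a1 = src M a2"
    and v: "var s ''a1'' = index es a1" "var s ''a2'' = index es a2"
    and as: "distinct as" "set as = El M" "non_ascending M as" "holds_list es as s"
    and D: "holds_table M es s"
    and e: "exec \<kappa> C JHasGreatestElement s = (s', r, t)"
  shows "(transp (ldiv M) \<longrightarrow> r = Some (of_bool (\<exists>c. is_greatest M (JS M a1 a2) c)))
    \<and> real t \<le> real (cost \<kappa> (card (El M)) JHasGreatestElement)"
proof -
  let ?xs = "map (index es) as"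
  let ?g = "\<exists>c. is_greatest M (JS M a1 a2) c"
  note i = index_El[OF a(1)] index_El[OF a(2)]
  have len: "length as = n" using distinct_card[OF as(1)] as(2) card_El by simp
  have map: "map ((!) es) ?xs = as"
    unfolding map_map o_def by (rule map_idI) (use as(2) index_El in auto)
  have set: "set ?xs = {..<n}"
    using as(2) index_El by (auto simp: image_iff) (metis index_nth nth_El)
  have st: "stores ?xs s"
    using D set len as(4) by (auto simp: stores_def holds_list_def)
  have "wp \<kappa> C JHasGreatestElement (\<lambda>_. False) (\<lambda>v _. transp (ldiv M) \<longrightarrow> v = of_bool ?g) s"
    unfolding JHasGreatestElement_eq
    by (intro wp_Seq wp_Assign, rule wp_mono,
        rule wp_j_loop[where i = "index es a1" and j = "index es a2" and xs = ?xs])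
       (use st v i a map set as(3) in \<open>auto intro!: wp_Return\<close>)
  from exec_wp[OF e this] show ?thesis by (auto split: option.splits)
qed

lemma is_garside_test_correct:
  assumes "exec \<kappa> C is_garside_test s = (s', r, t)"
  shows "r = Some (of_bool (left_associative M \<and> garside_germ M))
    \<and> real t \<le> real (cost \<kappa> (card (El M)) is_garside_test)"
  using exec_wp[OF assms wp_is_garside_test]
  unfolding left_associative_garside_germ_iff[OF germ_axioms] by (auto split: option.splits)

end

theorem proposition3p19:
  shows
    "(\<forall>\<kappa>. \<exists>T \<in> O(\<lambda>n. real n ^ 3). \<forall>(M :: ('o, 'a) pmon) es s s' r t.
        germ M \<and> finite (El M) \<and> enumerates es M \<and>
        exec \<kappa> (code M es) IsLeftAssociative s = (s', r, t) \<longrightarrow>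
        r = Some (of_bool (left_associative M)) \<and>
        real t \<le> T (card (El M)))
   \<and> (\<forall>\<kappa>. \<exists>T \<in> O(\<lambda>n. real n ^ 2). \<forall>(M :: ('o, 'a) pmon) es s s' r t.
        germ M \<and> finite (El M) \<and> enumerates es M \<and>
        exec \<kappa> (code M es) LeftDivisibility s = (s', r, t) \<longrightarrow>
        r = Some (of_bool (left_cancellative M)) \<and>
        (left_cancellative M \<longrightarrow> holds_table M es s') \<and>
        real t \<le> T (card (El M)))
   \<and> (\<forall>\<kappa>. \<exists>T \<in> O(\<lambda>n. real n ^ 2). \<forall>(M :: ('o, 'a) pmon) es s s' r t.
        germ M \<and> finite (El M) \<and> enumerates es M \<and>
        holds_table M es s \<and>
        exec \<kappa> (code M es) NonAscending s = (s', r, t) \<longrightarrow>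
        (\<exists>as. holds_list es as s' \<and> distinct as \<and> set as = El M \<and>
              (transp (ldiv M) \<longrightarrow> non_ascending M as)) \<and>
        real t \<le> T (card (El M)))
   \<and> (\<forall>\<kappa>. \<exists>T \<in> O(\<lambda>n. real n). \<forall>(M :: ('o, 'a) pmon) es as a1 a2 s s' r t.
        germ M \<and> finite (El M) \<and> enumerates es M \<and>
        a1 \<in> El M \<and> a2 \<in> El M \<and> tgt M a1 = src M a2 \<and>
        var s ''a1'' = index es a1 \<and> var s ''a2'' = index es a2 \<and>
        distinct as \<and> set as = El M \<and> non_ascending M as \<and> holds_list es as s \<and>
        holds_table M es s \<and>
        exec \<kappa> (code M es) JHasGreatestElement s = (s', r, t) \<longrightarrow>
        (transp (ldiv M) \<longrightarrow> r = Some (of_bool (\<exists>c. is_greatest M (JS M a1 a2) c))) \<and>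
        real t \<le> T (card (El M)))
   \<and> (\<exists>P. \<forall>\<kappa>. \<exists>T \<in> O(\<lambda>n. real n ^ 3). \<forall>(M :: ('o, 'a) pmon) es s s' r t.
        germ M \<and> finite (El M) \<and> enumerates es M \<and>
        exec \<kappa> (code M es) P s = (s', r, t) \<longrightarrow>
        r = Some (of_bool (left_associative M \<and> garside_germ M)) \<and>
        real t \<le> T (card (El M)))"
proof -
  have coded: "coded_germ M es" if "germ M" "enumerates es M" for M :: "('o, 'a) pmon" and es
    using that by (simp add: coded_germ_def coded_germ_axioms_def)
  note depth = IsLeftAssociative_eq LeftDivisibility_eq NonAscending_eq JHasGreatestElement_eq
    is_garside_test_def la_loop_def ld_loop_def na_body_def j_loop_def
  have depths: "loop_depth IsLeftAssociative = 3" "loop_depth LeftDivisibility = 2"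
    "loop_depth NonAscending = 2" "loop_depth JHasGreatestElement = 1"
    "loop_depth is_garside_test = 3"
    by (simp_all add: depth)
  note bigo = depths[THEN cost_bigo_depth]
  show ?thesis
  proof (intro conjI allI exI[of _ is_garside_test], goal_cases)
    case 1
    show ?case
      by (intro bexI[OF _ bigo(1)] allI impI, elim conjE)
         (rule coded_germ.IsLeftAssociative_correct[OF coded])
  next
    case 2
    show ?case
      by (intro bexI[OF _ bigo(2)] allI impI, elim conjE)
         (rule coded_germ.LeftDivisibility_correct[OF coded])
  next
    case 3
    show ?case
      by (intro bexI[OF _ bigo(3)] allI impI, elim conjE)
         (rule coded_germ.NonAscending_correct[OF coded])
  next
    case 4
    show ?case
      by (intro bexI[OF _ bigo(4)[unfolded power_one_right]] allI impI, elim conjE)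
         (rule coded_germ.JHasGreatestElement_correct[OF coded])
  next
    case 5
    show ?case
      by (intro bexI[OF _ bigo(5)] allI impI, elim conjE)
         (rule coded_germ.is_garside_test_correct[OF coded])
  qed
qed

end
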